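(* Let $[\mathbf G,\mathbf o]$ be a unimodular network and let $w_i:\mathcal G_*\to\mathbb R^{\ge0}$ be measurable functions for $i=1,2$. If $$\mathbb E[w_1[\mathbf G,\mathbf o]\mid I]=\mathbb E[w_2[\mathbf G,\mathbf o]\mid I]<\infty\quad\text{a.s.},$$ then the function $T$ constructed by the stable transport algorithm (described in the context) from $w_1,w_2$ is an invariant transport kernel that almost surely balances between $w_1[\mathbf G,\cdot]$ and $w_2[\mathbf G,\cdot]$; i.e. $T$ is a measurable function on $\mathcal G_{**}$ and almost surely $T_{\mathbf G}^+(v)=w_1[\mathbf G,v]$ and $T_{\mathbf G}^-(v)=w_2[\mathbf G,v]$ for all $v\in V(\mathbf G)$.
   Context: Networks. Fix a complete separable metric space $\Xi$ (the mark space). A network is a connected, locally finite (every vertex has finite degree) multigraph $G$ with vertex set $V(G)$, together with a mark in $\Xi$ for each vertex $v$ and for each pair $(v,e)$ with $e$ an edge incident to $v$. A rooted network $(G,o)$ is a network with a distinguished vertex $o$; a doubly-rooted network $(G,o,v)$ has an ordered pair of distinguished vertices. Isomorphisms preserve marks and distinguished vertices. $\mathcal G_*$ and $\mathcal G_{**}$ are the sets of isomorphism classes $[G,o]$ and $[G,o,v]$ of rooted and doubly-rooted networks, with their Borel sigma-fields for the (Polish) local topologies: $[G_n,o_n]\to[G,o]$ iff for all $r\in\mathbb N$ and $\varepsilon>0$, for all large $n$ there is a graph isomorphism between the balls of radius $r$ about the roots that maps root to root and for which corresponding marks are at distance less than $\varepsilon$; for $\mathcal G_{**}$ one uses balls about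 the first root, with $r$ at least the distance of the two roots in the limit, and isomorphisms must also map second root to second root. For a function $f$ we write $f[G,o]$ for $f([G,o])$, etc. A random rooted network $[\mathbf G,\mathbf o]$ is a random element of $\mathcal G_*$. $d(\cdot,\cdot)$ is graph distance and $N_r(v)$ is the set of vertices at distance at most $r$ from $v$. For $T:\mathcal G_{**}\to\mathbb R^{\ge0}$ measurable (an invariant transport kernel): $T_G(u,v)=T[G,u,v]$, $T_G^+(o)=\sum_{v\in V(G)}T_G(o,v)$, $T_G^-(o)=\sum_{v\in V(G)}T_G(v,o)$. Unimodular: $[\mathbf G,\mathbf o]$ is unimodular (a "unimodular network") if $\mathbb E[g_{\mathbf G}^+(\mathbf o)]=\mathbb E[g_{\mathbf G}^-(\mathbf o)]$ for all measurable $g:\mathcal G_{**}\to\mathbb R^{\ge0}$ (both sides may be infinite). Invariant sigma-field $I$: the family of measurable $A\subseteq\mathcal G_*$ such that $[G,o]\in A$ and $v\in V(G)$ imply $[G,v]\in A$. $\mathbb E[\,\cdot\mid I]$ is conditional expectation given the events $\{[\mathbf G,\mathbf o]\in A\}$, $A\in I$. Stable transport algorithm. Given a deterministic network $G$ and measurable $w_1,w_2:\mathcal G_*\to\mathbb R^{\ge0}$, let $R_0(x,\xi)=0$ for all $x,\xi\in V(G)$. The minimum of the empty set is $\infty$. For each $n\ge1$: (1) For each $x_0\in V(G)$ let $a_n(x_0)=\min\{a\ge0:\sum_{\xi\in N_a(x_0)}(w_2[G,\xi]-R_{n-1}(x_0,\xi))\ge w_1[G,x_0]\}$, and define $A_n(x_0,\xi)$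 to be $w_2[G,\xi]$ if $d(x_0,\xi)<a_n(x_0)$; $cR_{n-1}(x_0,\xi)+(1-c)w_2[G,\xi]$ if $d(x_0,\xi)=a_n(x_0)$; and $0$ if $d(x_0,\xi)>a_n(x_0)$, where, when $a_n(x_0)<\infty$, $c=c_n(x_0)\in[0,1]$ is chosen such that $\sum_{\xi\in V(G)}(A_n(x_0,\xi)-R_{n-1}(x_0,\xi))=w_1[G,x_0]$. (2) For each $\xi_0\in V(G)$ let $r_n(\xi_0)=\min\{r\ge0:\sum_{x\in N_r(\xi_0)}A_n(x,\xi_0)\ge w_2[G,\xi_0]\}$, and define $R_n(x,\xi_0)$ to be $0$ if $d(x,\xi_0)<r_n(\xi_0)$; $c'A_n(x,\xi_0)$ if $d(x,\xi_0)=r_n(\xi_0)$; and $A_n(x,\xi_0)$ if $d(x,\xi_0)>r_n(\xi_0)$, where, when $r_n(\xi_0)<\infty$, $c'=c'_n(\xi_0)\in[0,1]$ is chosen such that $\sum_{x\in V(G)}(A_n(x,\xi_0)-R_n(x,\xi_0))=w_2[G,\xi_0]$. Finally $T_G(x,\xi):=\lim_{n\to\infty}A_n(x,\xi)-\lim_{n\to\infty}R_n(x,\xi)$ (the sequences $A_n(x,\xi)$ and $R_n(x,\xi)$ are non-decreasing in $n$ and bounded by $w_2[G,\xi]$, so the limits exist). *)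

theory Defs
  imports "HOL-Probability.Probability"
begin

section \<open>Networks\<close>

text \<open>
  Multigraphs with marks. A loop at \<open>v\<close> is an edge \<open>e\<close> with \<open>ends G e = {v}\<close>. Only the values of
  \<open>vmark\<close> on vertices and of \<open>emark G v e\<close> on incident pairs \<open>(v, e)\<close> matter. A connected locally
  finite multigraph has countably many vertices and edges, so up to isomorphism every network has
  its vertices and edges in \<open>nat\<close>.
\<close>

record 'm network =
  verts :: "nat set"
  edges :: "nat set"
  ends :: "nat \<Rightarrow> nat set"
  vmark :: "nat \<Rightarrow> 'm"
  emark :: "nat \<Rightarrow> nat \<Rightarrow> 'm"

definition adj :: "'m network \<Rightarrow> (nat \<times> nat) set" where
  "adj G = {(u, v). \<exists>e\<in>edges G. ends G e = {u, v}}"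

definition is_network :: "'m network \<Rightarrow> bool" where
  "is_network G \<longleftrightarrow>
     (\<forall>e\<in>edges G. \<exists>u\<in>verts G. \<exists>v\<in>verts G. ends G e = {u, v}) \<and>
     (\<forall>v\<in>verts G. finite {e\<in>edges G. v \<in> ends G e}) \<and>
     (\<forall>u\<in>verts G. \<forall>v\<in>verts G. (u, v) \<in> (adj G)\<^sup>*)"

definition gdist :: "'m network \<Rightarrow> nat \<Rightarrow> nat \<Rightarrow> nat" where
  "gdist G u v = (LEAST n. (u, v) \<in> adj G ^^ n)"

definition nbhd :: "'m network \<Rightarrow> nat \<Rightarrow> nat \<Rightarrow> nat set" where
  "nbhd G r v = {u\<in>verts G. gdist G v u \<le> r}"

definition ball_net :: "'m network \<Rightarrow> nat \<Rightarrow> nat \<Rightarrow> 'm network" where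
  "ball_net G r v =
     G\<lparr>verts := nbhd G r v, edges := {e\<in>edges G. ends G e \<subseteq> nbhd G r v}\<rparr>"

definition graph_iso ::
  "'m network \<Rightarrow> 'm network \<Rightarrow> (nat \<Rightarrow> nat) \<Rightarrow> (nat \<Rightarrow> nat) \<Rightarrow> bool" where
  "graph_iso G H \<phi> \<psi> \<longleftrightarrow>
     bij_betw \<phi> (verts G) (verts H) \<and> bij_betw \<psi> (edges G) (edges H) \<and>
     (\<forall>e\<in>edges G. ends H (\<psi> e) = \<phi> ` ends G e)"

definition marks_rel ::
  "('m \<Rightarrow> 'm \<Rightarrow> bool) \<Rightarrow> 'm network \<Rightarrow> 'm network \<Rightarrow> (nat \<Rightarrow> nat) \<Rightarrow> (nat \<Rightarrow> nat) \<Rightarrow> bool" where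
  "marks_rel R G H \<phi> \<psi> \<longleftrightarrow>
     (\<forall>v\<in>verts G. R (vmark G v) (vmark H (\<phi> v))) \<and>
     (\<forall>e\<in>edges G. \<forall>v\<in>ends G e. R (emark G v e) (emark H (\<phi> v) (\<psi> e)))"

definition network_iso ::
  "'m network \<Rightarrow> 'm network \<Rightarrow> (nat \<Rightarrow> nat) \<Rightarrow> (nat \<Rightarrow> nat) \<Rightarrow> bool" where
  "network_iso G H \<phi> \<psi> \<longleftrightarrow> graph_iso G H \<phi> \<psi> \<and> marks_rel (=) G H \<phi> \<psi>"

lemma network_iso_refl: "network_iso G G id id"
  by (auto simp: network_iso_def graph_iso_def marks_rel_def)

lemma network_iso_sym:
  assumes "network_iso G H \<phi> \<psi>" "is_network G"
  shows "network_iso H G (inv_into (verts G) \<phi>) (inv_into (edges G) \<psi>)"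
proof -
  let ?f = "inv_into (verts G) \<phi>" and ?g = "inv_into (edges G) \<psi>"
  have b: "bij_betw \<phi> (verts G) (verts H)" "bij_betw \<psi> (edges G) (edges H)"
    and e: "\<And>e. e \<in> edges G \<Longrightarrow> ends H (\<psi> e) = \<phi> ` ends G e"
    and vm: "\<And>v. v \<in> verts G \<Longrightarrow> vmark G v = vmark H (\<phi> v)"
    and em: "\<And>e v. e \<in> edges G \<Longrightarrow> v \<in> ends G e \<Longrightarrow> emark G v e = emark H (\<phi> v) (\<psi> e)"
    using assms(1) by (auto simp: network_iso_def graph_iso_def marks_rel_def)
  have f\<phi>: "?f (\<phi> v) = v" if "v \<in> verts G" for v
    using b(1) that by (simp add: bij_betw_inv_into_left)
  have g\<psi>: "?g (\<psi> e) = e" if "e \<in> edges G" for e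
    using b(2) that by (simp add: bij_betw_inv_into_left)
  have sub: "ends G e \<subseteq> verts G" if "e \<in> edges G" for e
    using assms(2) that unfolding is_network_def by force
  have img: "?f ` \<phi> ` ends G e = ends G e" if "e \<in> edges G" for e
    using sub[OF that] f\<phi> by (force simp: image_image)
  have vH: "\<exists>v\<in>verts G. x = \<phi> v" if "x \<in> verts H" for x
    using b(1) that by (auto simp: bij_betw_def)
  have eH: "\<exists>e\<in>edges G. x = \<psi> e" if "x \<in> edges H" for x
    using b(2) that by (auto simp: bij_betw_def)
  have "graph_iso H G ?f ?g"
    unfolding graph_iso_def
  proof (intro conjI ballI)
    show "bij_betw ?f (verts H) (verts G)" "bij_betw ?g (edges H) (edges G)"
      using b by (auto intro: bij_betw_inv_into)
    fix x assume "x \<in> edges H"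
    then obtain e' where "e' \<in> edges G" "x = \<psi> e'" using eH by blast
    then show "ends G (?g x) = ?f ` ends H x" using g\<psi> e img by simp
  qed
  moreover have "marks_rel (=) H G ?f ?g"
    unfolding marks_rel_def
  proof (intro conjI ballI)
    fix x assume "x \<in> verts H"
    then show "vmark H x = vmark G (?f x)" using vH vm f\<phi> by force
  next
    fix x y assume "x \<in> edges H" "y \<in> ends H x"
    then obtain e' where e': "e' \<in> edges G" "x = \<psi> e'" using eH by blast
    then obtain v where v: "v \<in> ends G e'" "y = \<phi> v" using \<open>y \<in> ends H x\<close> e by auto
    then have "v \<in> verts G" using sub e' by blast
    then show "emark H y x = emark G (?f y) (?g x)" using v e' em[of e' v] f\<phi> g\<psi> by simp
  qed
  ultimately show ?thesis by (simp add: network_iso_def)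
qed

lemma network_iso_trans:
  assumes "network_iso G H \<phi> \<psi>" "network_iso H K \<phi>' \<psi>'"
  shows "network_iso G K (\<phi>' \<circ> \<phi>) (\<psi>' \<circ> \<psi>)"
proof -
  have "\<psi> e \<in> edges H" if "e \<in> edges G" for e
    using assms(1) that by (auto simp: network_iso_def graph_iso_def bij_betw_def)
  moreover have "\<phi> v \<in> verts H" if "v \<in> verts G" for v
    using assms(1) that by (auto simp: network_iso_def graph_iso_def bij_betw_def)
  ultimately show ?thesis
    using assms unfolding network_iso_def graph_iso_def marks_rel_def
    by (auto intro: bij_betw_trans simp: image_comp)
qed


section \<open>The spaces of rooted and doubly-rooted networks\<close>

definition rooted_iso :: "'m network \<times> nat \<Rightarrow> 'm network \<times> nat \<Rightarrow> bool" where
  "rooted_iso = (\<lambda>(G, u) (H, p).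
     is_network G \<and> u \<in> verts G \<and> is_network H \<and> p \<in> verts H \<and>
     (\<exists>\<phi> \<psi>. network_iso G H \<phi> \<psi> \<and> \<phi> u = p))"

definition drooted_iso :: "'m network \<times> nat \<times> nat \<Rightarrow> 'm network \<times> nat \<times> nat \<Rightarrow> bool" where
  "drooted_iso = (\<lambda>(G, u, v) (H, p, q).
     is_network G \<and> u \<in> verts G \<and> v \<in> verts G \<and>
     is_network H \<and> p \<in> verts H \<and> q \<in> verts H \<and>
     (\<exists>\<phi> \<psi>. network_iso G H \<phi> \<psi> \<and> \<phi> u = p \<and> \<phi> v = q))"

definition point_network :: "'m \<Rightarrow> 'm network" where
  "point_network m =
     \<lparr>verts = {0}, edges = {}, ends = (\<lambda>_. {}), vmark = (\<lambda>_. m), emark = (\<lambda>_ _. m)\<rparr>"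

lemma is_network_point: "is_network (point_network m)" "0 \<in> verts (point_network m)"
  by (auto simp: is_network_def point_network_def)

lemma network_iso_inv_root:
  assumes "network_iso G H \<phi> \<psi>" "u \<in> verts G"
  shows "inv_into (verts G) \<phi> (\<phi> u) = u"
  using assms by (auto simp: network_iso_def graph_iso_def bij_betw_inv_into_left)

quotient_type 'm rnet = "'m network \<times> nat" / partial: rooted_iso
proof (rule part_equivpI)
  show "\<exists>x. rooted_iso x (x :: 'm network \<times> nat)"
    by (rule exI[of _ "(point_network undefined, 0)"])
      (use is_network_point network_iso_refl in \<open>force simp: rooted_iso_def\<close>)
  show "symp (rooted_iso :: 'm network \<times> nat \<Rightarrow> _)"
    by (rule sympI)
      (auto simp: rooted_iso_def intro!: exI dest: network_iso_sym intro: network_iso_inv_root)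
  show "transp (rooted_iso :: 'm network \<times> nat \<Rightarrow> _)"
    by (rule transpI) (auto simp: rooted_iso_def intro!: exI dest: network_iso_trans)
qed

quotient_type 'm dnet = "'m network \<times> nat \<times> nat" / partial: drooted_iso
proof (rule part_equivpI)
  show "\<exists>x. drooted_iso x (x :: 'm network \<times> nat \<times> nat)"
    by (rule exI[of _ "(point_network undefined, 0, 0)"])
      (use is_network_point network_iso_refl in \<open>force simp: drooted_iso_def\<close>)
  show "symp (drooted_iso :: 'm network \<times> nat \<times> nat \<Rightarrow> _)"
    by (rule sympI)
      (auto simp: drooted_iso_def intro!: exI dest: network_iso_sym intro: network_iso_inv_root)
  show "transp (drooted_iso :: 'm network \<times> nat \<times> nat \<Rightarrow> _)"
    by (rule transpI) (auto simp: drooted_iso_def intro!: exI dest: network_iso_trans)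
qed

definition rcls :: "'m network \<Rightarrow> nat \<Rightarrow> 'm rnet" where
  "rcls G u = abs_rnet (G, u)"

definition dcls :: "'m network \<Rightarrow> nat \<Rightarrow> nat \<Rightarrow> 'm dnet" where
  "dcls G u v = abs_dnet (G, u, v)"

lemma rcls_eq_iff:
  assumes "is_network G" "u \<in> verts G" "is_network H" "p \<in> verts H"
  shows "rcls G u = rcls H p \<longleftrightarrow> (\<exists>\<phi> \<psi>. network_iso G H \<phi> \<psi> \<and> \<phi> u = p)"
proof -
  have refl: "rooted_iso (K, k) (K, k)" if "is_network K" "k \<in> verts K" for K :: "'m network" and k
    using that network_iso_refl[of K] by (force simp: rooted_iso_def)
  have "rcls G u = rcls H p \<longleftrightarrow> rooted_iso (G, u) (H, p)"
    unfolding rcls_def using Quotient3_rel[OF Quotient3_rnet, of "(G, u)" "(H, p)"] refl assms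
    by blast
  then show ?thesis using assms by (simp add: rooted_iso_def)
qed

lemma dcls_eq_iff:
  assumes "is_network G" "u \<in> verts G" "v \<in> verts G" "is_network H" "p \<in> verts H" "q \<in> verts H"
  shows "dcls G u v = dcls H p q \<longleftrightarrow> (\<exists>\<phi> \<psi>. network_iso G H \<phi> \<psi> \<and> \<phi> u = p \<and> \<phi> v = q)"
proof -
  have refl: "drooted_iso (K, k, l) (K, k, l)" if "is_network K" "k \<in> verts K" "l \<in> verts K"
    for K :: "'m network" and k l
    using that network_iso_refl[of K] by (force simp: drooted_iso_def)
  have "dcls G u v = dcls H p q \<longleftrightarrow> drooted_iso (G, u, v) (H, p, q)"
    unfolding dcls_def using Quotient3_rel[OF Quotient3_dnet, of "(G, u, v)" "(H, p, q)"] refl assms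
    by blast
  then show ?thesis using assms by (simp add: drooted_iso_def)
qed

lemma rnet_cases:
  obtains G u where "is_network G" "u \<in> verts G" "x = rcls G u"
proof -
  obtain G u where *: "rep_rnet x = (G, u)" by force
  have "rooted_iso (G, u) (G, u)" using Quotient3_rep_reflp[OF Quotient3_rnet, of x] * by simp
  moreover have "x = rcls G u" using Quotient3_abs_rep[OF Quotient3_rnet, of x] * by (simp add: rcls_def)
  ultimately show ?thesis using that by (auto simp: rooted_iso_def)
qed

lemma dnet_cases:
  obtains G u v where "is_network G" "u \<in> verts G" "v \<in> verts G" "x = dcls G u v"
proof -
  obtain G u v where *: "rep_dnet x = (G, u, v)" by (metis prod_cases3)
  have "drooted_iso (G, u, v) (G, u, v)"
    using Quotient3_rep_reflp[OF Quotient3_dnet, of x] * by simp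
  moreover have "x = dcls G u v"
    using Quotient3_abs_rep[OF Quotient3_dnet, of x] * by (simp add: dcls_def)
  ultimately show ?thesis using that by (auto simp: drooted_iso_def)
qed

definition ball_iso ::
  "real \<Rightarrow> 'm::metric_space network \<Rightarrow> 'm network \<Rightarrow> (nat \<Rightarrow> nat) \<Rightarrow> (nat \<Rightarrow> nat) \<Rightarrow> bool" where
  "ball_iso \<epsilon> B C \<phi> \<psi> \<longleftrightarrow> graph_iso B C \<phi> \<psi> \<and> marks_rel (\<lambda>a b. dist a b < \<epsilon>) B C \<phi> \<psi>"

definition rnear :: "nat \<Rightarrow> real \<Rightarrow> 'm::metric_space rnet \<Rightarrow> 'm rnet \<Rightarrow> bool" where
  "rnear r \<epsilon> x y \<longleftrightarrow> (\<exists>G u H p.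
     is_network G \<and> u \<in> verts G \<and> x = rcls G u \<and> is_network H \<and> p \<in> verts H \<and> y = rcls H p \<and>
     (\<exists>\<phi> \<psi>. ball_iso \<epsilon> (ball_net G r u) (ball_net H r p) \<phi> \<psi> \<and> \<phi> u = p))"

definition dnear :: "nat \<Rightarrow> real \<Rightarrow> 'm::metric_space dnet \<Rightarrow> 'm dnet \<Rightarrow> bool" where
  "dnear r \<epsilon> x y \<longleftrightarrow> (\<exists>G u v H p q.
     is_network G \<and> u \<in> verts G \<and> v \<in> verts G \<and> x = dcls G u v \<and>
     is_network H \<and> p \<in> verts H \<and> q \<in> verts H \<and> y = dcls H p q \<and>
     (gdist G u v \<le> r \<longrightarrow>
       (\<exists>\<phi> \<psi>. ball_iso \<epsilon> (ball_net G r u) (ball_net H r p) \<phi> \<psi> \<and> \<phi> u = p \<and> \<phi> v = q)))"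

definition rconv :: "(nat \<Rightarrow> 'm::metric_space rnet) \<Rightarrow> 'm rnet \<Rightarrow> bool" where
  "rconv X x \<longleftrightarrow> (\<forall>r. \<forall>\<epsilon>>0. \<forall>\<^sub>F n in sequentially. rnear r \<epsilon> x (X n))"

definition dconv :: "(nat \<Rightarrow> 'm::metric_space dnet) \<Rightarrow> 'm dnet \<Rightarrow> bool" where
  "dconv X x \<longleftrightarrow> (\<forall>r. \<forall>\<epsilon>>0. \<forall>\<^sub>F n in sequentially. dnear r \<epsilon> x (X n))"

text \<open>
  The local topologies are metrizable, hence determined by their convergent sequences: the open
  sets are the sequentially open ones.
\<close>

instantiation rnet :: (metric_space) topological_space
begin

definition open_rnet :: "'a rnet set \<Rightarrow> bool" where
  "open_rnet U \<longleftrightarrow> (\<forall>X. \<forall>x\<in>U. rconv X x \<longrightarrow> (\<forall>\<^sub>F n in sequentially. X n \<in> U))"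

instance
proof
  show "open (UNIV :: 'a rnet set)" by (simp add: open_rnet_def)
  show "open (S \<inter> T)" if "open S" "open T" for S T :: "'a rnet set"
    using that unfolding open_rnet_def by (auto intro!: eventually_conj)
  show "open (\<Union>K)" if "\<forall>S\<in>K. open S" for K :: "'a rnet set set"
    using that unfolding open_rnet_def by (blast intro: eventually_mono)
qed

end

instantiation dnet :: (metric_space) topological_space
begin

definition open_dnet :: "'a dnet set \<Rightarrow> bool" where
  "open_dnet U \<longleftrightarrow> (\<forall>X. \<forall>x\<in>U. dconv X x \<longrightarrow> (\<forall>\<^sub>F n in sequentially. X n \<in> U))"

instance
proof
  show "open (UNIV :: 'a dnet set)" by (simp add: open_dnet_def)
  show "open (S \<inter> T)" if "open S" "open T" for S T :: "'a dnet set"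
    using that unfolding open_dnet_def by (auto intro!: eventually_conj)
  show "open (\<Union>K)" if "\<forall>S\<in>K. open S" for K :: "'a dnet set set"
    using that unfolding open_dnet_def by (blast intro: eventually_mono)
qed

end


section \<open>Unimodularity and the invariant sigma-field\<close>

definition outflow :: "('m dnet \<Rightarrow> real) \<Rightarrow> 'm network \<Rightarrow> nat \<Rightarrow> ennreal" where
  "outflow T G u = (\<Sum>\<^sub>\<infinity>v\<in>verts G. ennreal (T (dcls G u v)))"

definition inflow :: "('m dnet \<Rightarrow> real) \<Rightarrow> 'm network \<Rightarrow> nat \<Rightarrow> ennreal" where
  "inflow T G u = (\<Sum>\<^sub>\<infinity>v\<in>verts G. ennreal (T (dcls G v u)))"

text \<open>
  \<open>outflow T\<close> and \<open>inflow T\<close> are isomorphism invariant, so below they may be evaluated at the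
  representative of the random class that \<open>rep_rnet\<close> selects.
\<close>

definition unimodular :: "'w measure \<Rightarrow> ('w \<Rightarrow> 'm::metric_space rnet) \<Rightarrow> bool" where
  "unimodular M X \<longleftrightarrow>
     (\<forall>g :: 'm dnet \<Rightarrow> real. g \<in> borel_measurable borel \<and> (\<forall>x. 0 \<le> g x) \<longrightarrow>
        (\<integral>\<^sup>+\<omega>. case_prod (outflow g) (rep_rnet (X \<omega>)) \<partial>M) =
        (\<integral>\<^sup>+\<omega>. case_prod (inflow g) (rep_rnet (X \<omega>)) \<partial>M))"

definition invariant_sets :: "'m::metric_space rnet set set" where
  "invariant_sets = {A \<in> sets borel.
     \<forall>G. is_network G \<longrightarrow> (\<forall>u\<in>verts G. \<forall>v\<in>verts G. rcls G u \<in> A \<longrightarrow> rcls G v \<in> A)}"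

definition invariant_field :: "'w measure \<Rightarrow> ('w \<Rightarrow> 'm::metric_space rnet) \<Rightarrow> 'w measure" where
  "invariant_field M X = sigma (space M) {X -` A \<inter> space M |A. A \<in> invariant_sets}"


section \<open>The stable transport algorithm\<close>

text \<open>
  In the two \<open>SOME\<close>-choices below any admissible constant yields the same values of \<open>applied\<close> and
  \<open>rejected\<close>: if the constant is not unique, then the sphere terms do not depend on it.
\<close>

context
  fixes G :: "'m network" and w1 w2 :: "'m rnet \<Rightarrow> real"
begin

definition apply_radius :: "(nat \<Rightarrow> nat \<Rightarrow> real) \<Rightarrow> nat \<Rightarrow> enat" where
  "apply_radius R x =
     Inf {enat a |a. (\<Sum>\<xi>\<in>nbhd G a x. w2 (rcls G \<xi>) - R x \<xi>) \<ge> w1 (rcls G x)}"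

definition applied_with :: "(nat \<Rightarrow> nat \<Rightarrow> real) \<Rightarrow> real \<Rightarrow> nat \<Rightarrow> nat \<Rightarrow> real" where
  "applied_with R c x \<xi> =
     (if enat (gdist G x \<xi>) < apply_radius R x then w2 (rcls G \<xi>)
      else if enat (gdist G x \<xi>) = apply_radius R x then c * R x \<xi> + (1 - c) * w2 (rcls G \<xi>)
      else 0)"

definition applied :: "(nat \<Rightarrow> nat \<Rightarrow> real) \<Rightarrow> nat \<Rightarrow> nat \<Rightarrow> real" where
  "applied R x = applied_with R
     (SOME c. c \<in> {0..1} \<and> (\<Sum>\<^sub>\<infinity>\<xi>\<in>verts G. applied_with R c x \<xi> - R x \<xi>) = w1 (rcls G x)) x"

definition reject_radius :: "(nat \<Rightarrow> nat \<Rightarrow> real) \<Rightarrow> nat \<Rightarrow> enat" where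
  "reject_radius A \<xi> =
     Inf {enat r |r. (\<Sum>x\<in>nbhd G r \<xi>. A x \<xi>) \<ge> w2 (rcls G \<xi>)}"

definition rejected_with :: "(nat \<Rightarrow> nat \<Rightarrow> real) \<Rightarrow> real \<Rightarrow> nat \<Rightarrow> nat \<Rightarrow> real" where
  "rejected_with A c x \<xi> =
     (if enat (gdist G x \<xi>) < reject_radius A \<xi> then 0
      else if enat (gdist G x \<xi>) = reject_radius A \<xi> then c * A x \<xi>
      else A x \<xi>)"

definition rejected :: "(nat \<Rightarrow> nat \<Rightarrow> real) \<Rightarrow> nat \<Rightarrow> nat \<Rightarrow> real" where
  "rejected A x \<xi> = rejected_with A
     (SOME c. c \<in> {0..1} \<and> (\<Sum>\<^sub>\<infinity>x\<in>verts G. A x \<xi> - rejected_with A c x \<xi>) = w2 (rcls G \<xi>)) x \<xi>"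

primrec rejection :: "nat \<Rightarrow> nat \<Rightarrow> nat \<Rightarrow> real" where
  "rejection 0 = (\<lambda>x \<xi>. 0)"
| "rejection (Suc n) = rejected (applied (rejection n))"

text \<open>Stages are numbered from 1; the value at \<open>n = 0\<close> has no meaning.\<close>

definition application :: "nat \<Rightarrow> nat \<Rightarrow> nat \<Rightarrow> real" where
  "application n = applied (rejection (n - 1))"

definition stable_transport :: "nat \<Rightarrow> nat \<Rightarrow> real" where
  "stable_transport x \<xi> = lim (\<lambda>n. application n x \<xi>) - lim (\<lambda>n. rejection n x \<xi>)"

end

end

theory Submission
  imports Defs
begin

text \<open>
  \<^emph>\<open>One rule for both steps.\<close> Given a demand \<open>w\<close> at a centre and a supply \<open>f\<close> on the vertices, the
  greedy rule takes supply in the order of the distance from the centre until \<open>w\<close> is met, and on the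
  last sphere it takes the same fraction of every item. In stage \<open>n\<close>, the vertex \<open>x\<close> is greedy for
  what it has not been refused: \<open>A\<^sub>n(x,\<cdot>) - R\<^sub>n\<^sub>-\<^sub>1(x,\<cdot>)\<close> is the greedy share of \<open>w\<^sub>2 - R\<^sub>n\<^sub>-\<^sub>1(x,\<cdot>)\<close> for the
  demand \<open>w\<^sub>1(x)\<close> (\<open>applied_eq_greedy\<close>); then the site \<open>\<xi>\<close> is greedy for the applications:
  \<open>A\<^sub>n(\<cdot>,\<xi>) - R\<^sub>n(\<cdot>,\<xi>)\<close> is the greedy share of \<open>A\<^sub>n(\<cdot>,\<xi>)\<close> for the demand \<open>w\<^sub>2(\<xi>)\<close> (\<open>rejected_eq_greedy\<close>).
  Two properties of the rule suffice: in every ball about the centre the share has total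
  \<open>min w (\<Sum>f)\<close> (\<open>sum_greedy_level\<close>), and the surplus \<open>f - share\<close> increases with \<open>f\<close>
  (\<open>greedy_surplus_mono\<close>). The second one makes \<open>A\<^sub>n\<close> and \<open>R\<^sub>n\<close> increase in \<open>n\<close>. Passing to the limit in
  the first one shows that the sums of \<open>T(x,\<cdot>)\<close> over balls about \<open>x\<close> are \<open>min (w\<^sub>1(x)) (\<Sum>(w\<^sub>2 - R))\<close>, and
  those of \<open>T(\<cdot>,\<xi>)\<close> over balls about \<open>\<xi>\<close> are \<open>min (w\<^sub>2(\<xi>)) (\<Sum>A(\<cdot>,\<xi>))\<close>. So \<open>T\<^sup>+ \<le> w\<^sub>1\<close> and \<open>T\<^sup>- \<le> w\<^sub>2\<close>; and
  if \<open>T\<^sup>+(x) < w\<^sub>1(x)\<close> for some \<open>x\<close>, then \<open>A(x,\<xi>) = w\<^sub>2(\<xi>)\<close> for all \<open>\<xi>\<close>, which forces \<open>T\<^sup>-(\<xi>) = w\<^sub>2(\<xi>)\<close>.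
  Hence in each network \<open>T\<^sup>+ = w\<^sub>1\<close> everywhere or \<open>T\<^sup>- = w\<^sub>2\<close> everywhere (\<open>stable_transport_balance\<close>).

  \<^emph>\<open>Mass transport.\<close> Unimodularity, applied to \<open>T\<close> times the indicator of an invariant event, shows
  that \<open>T\<^sup>+\<close> and \<open>T\<^sup>-\<close> have the same integral over that event (\<open>unimodular_restricted\<close>), and by
  hypothesis so do \<open>w\<^sub>1\<close> and \<open>w\<^sub>2\<close>. On the invariant event that \<open>T\<^sup>+ = w\<^sub>1\<close> everywhere, \<open>T\<^sup>-\<close> therefore has
  the same integral as \<open>w\<^sub>2 \<ge> T\<^sup>-\<close>, and they agree almost surely once the integral is finite; this
  holds on the events that the conditional expectation is at most \<open>k\<close>, which exhaust the space up to a null set. The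
  event that \<open>T\<^sup>- = w\<^sub>2\<close> everywhere is treated in the same way. This gives balance at the root, and a
  further mass transport carries it to all vertices (\<open>AE_everywhere\<close>).

  \<^emph>\<open>Measurability.\<close> The greedy share is an explicit function of sums over spheres, so it is enough
  that the sum of \<open>f[G,o,v]\<close> over the vertices \<open>v\<close> is a Borel function of \<open>[G,o]\<close> for every Borel
  \<open>f \<ge> 0\<close> (\<open>measurable_vertex_sum\<close>). If \<open>f\<close> is the indicator of an open set, then the sum is lower
  semicontinuous, because the vertices of the limit of a convergent sequence can be followed along
  the sequence (\<open>rconv_vertices\<close>). A Dynkin argument and monotone limits give the general case.
\<close>

section \<open>Greedy allocation by distance\<close>
text \<open>
  The clamped quotient is the fraction that is taken from the sphere of \<open>\<xi>\<close>: it is 1 as long as the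
  demand exceeds the supply up to and including that sphere, and 0 as soon as the smaller spheres
  meet the demand. On a sphere without supply the quotient is 0 by convention; for
  nonnegative \<open>f\<close> this is harmless because \<open>f \<xi> = 0\<close> there.
\<close>

definition greedy :: "'a set \<Rightarrow> ('a \<Rightarrow> nat) \<Rightarrow> real \<Rightarrow> ('a \<Rightarrow> real) \<Rightarrow> 'a \<Rightarrow> real" where
  "greedy V k w f \<xi> = f \<xi> *
     max 0 (min 1 ((w - (\<Sum>\<eta>\<in>{\<eta>\<in>V. k \<eta> < k \<xi>}. f \<eta>)) / (\<Sum>\<eta>\<in>{\<eta>\<in>V. k \<eta> = k \<xi>}. f \<eta>)))"

text \<open>
  The grading \<open>k\<close> stands for the distance from the centre. Only the finiteness of balls matters for
  the greedy rule, so it can be studied with a single grading instead of a metric.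
\<close>

locale graded_supply =
  fixes V :: "'a set" and k :: "'a \<Rightarrow> nat"
  assumes finite_level: "finite {\<eta>\<in>V. k \<eta> \<le> r}"
begin

lemma finite_sublevel [simp]: "finite {\<eta>\<in>V. k \<eta> < r}" "finite {\<eta>\<in>V. k \<eta> = r}"
  by (rule finite_subset[OF _ finite_level[of r]]; auto)+

lemma sum_level_split:
  "(\<Sum>\<eta>\<in>{\<eta>\<in>V. k \<eta> \<le> r}. f \<eta>) = (\<Sum>\<eta>\<in>{\<eta>\<in>V. k \<eta> < r}. f \<eta>) + (\<Sum>\<eta>\<in>{\<eta>\<in>V. k \<eta> = r}. f \<eta> :: real)"
proof -
  have "{\<eta>\<in>V. k \<eta> \<le> r} = {\<eta>\<in>V. k \<eta> < r} \<union> {\<eta>\<in>V. k \<eta> = r}" by auto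
  then show ?thesis by (simp only:) (rule sum.union_disjoint; auto)
qed

lemma greedy_bounds:
  assumes "f \<xi> \<ge> 0"
  shows "0 \<le> greedy V k w f \<xi>" "greedy V k w f \<xi> \<le> f \<xi>"
  using assms by (auto simp: greedy_def intro: mult_left_le)

lemma member_zero_of_sphere_zero:
  assumes "\<And>\<eta>. \<eta> \<in> V \<Longrightarrow> 0 \<le> f \<eta>" "\<xi> \<in> V" "(\<Sum>\<eta>\<in>{\<eta>\<in>V. k \<eta> = k \<xi>}. f \<eta>) = (0::real)"
  shows "f \<xi> = 0"
  using sum_nonneg_0[OF finite_sublevel(2)[of "k \<xi>"] _ assms(3), of \<xi>] assms(1,2) by auto

text \<open>
  The amount that is taken from a sphere is the demand which the smaller spheres leave open,
  truncated to the interval from 0 to the supply of the sphere. Summing sphere by sphere, the total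
  follows the supply until it reaches \<open>w\<close> and then stays constant.
\<close>

lemma sum_greedy_level:
  assumes f: "\<And>\<eta>. \<eta> \<in> V \<Longrightarrow> 0 \<le> f \<eta>" and w: "0 \<le> w"
  shows "(\<Sum>\<eta>\<in>{\<eta>\<in>V. k \<eta> \<le> r}. greedy V k w f \<eta>) = min w (\<Sum>\<eta>\<in>{\<eta>\<in>V. k \<eta> \<le> r}. f \<eta>)"
proof -
  let ?lt = "\<lambda>r. \<Sum>\<eta>\<in>{\<eta>\<in>V. k \<eta> < r}. f \<eta>"
  let ?eq = "\<lambda>r. \<Sum>\<eta>\<in>{\<eta>\<in>V. k \<eta> = r}. f \<eta>"
  have nn: "0 \<le> ?eq r" for r by (rule sum_nonneg) (use f in auto)
  have sphere: "(\<Sum>\<eta>\<in>{\<eta>\<in>V. k \<eta> = r}. greedy V k w f \<eta>) = max 0 (min (?eq r) (w - ?lt r))" for r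
  proof -
    have "(\<Sum>\<eta>\<in>{\<eta>\<in>V. k \<eta> = r}. greedy V k w f \<eta>) = ?eq r * max 0 (min 1 ((w - ?lt r) / ?eq r))"
      unfolding sum_distrib_right by (rule sum.cong) (auto simp: greedy_def)
    also have "\<dots> = max 0 (min (?eq r) (w - ?lt r))"
      using nn[of r] by (cases "?eq r = 0") (auto simp: max_def min_def field_simps)
    finally show ?thesis .
  qed
  have below: "(\<Sum>\<eta>\<in>{\<eta>\<in>V. k \<eta> < r}. greedy V k w f \<eta>) = min w (?lt r)" for r
  proof (induction r)
    case 0
    show ?case using w by simp
  next
    case (Suc r)
    have [simp]: "{\<eta>\<in>V. k \<eta> < Suc r} = {\<eta>\<in>V. k \<eta> \<le> r}" by auto
    show ?case using Suc sphere[of r] nn[of r] by (simp add: sum_level_split)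
  qed
  show ?thesis using below[of r] sphere[of r] nn[of r] by (simp add: sum_level_split)
qed

lemma greedy_takes_all:
  assumes f: "\<And>\<eta>. \<eta> \<in> V \<Longrightarrow> 0 \<le> f \<eta>" and "\<xi> \<in> V"
    and le: "(\<Sum>\<eta>\<in>{\<eta>\<in>V. k \<eta> \<le> k \<xi>}. f \<eta>) \<le> w"
  shows "greedy V k w f \<xi> = f \<xi>"
proof (cases "(\<Sum>\<eta>\<in>{\<eta>\<in>V. k \<eta> = k \<xi>}. f \<eta>) = 0")
  case True
  then show ?thesis using member_zero_of_sphere_zero[of f, OF f \<open>\<xi> \<in> V\<close>] by (simp add: greedy_def)
next
  case False
  moreover have "0 \<le> (\<Sum>\<eta>\<in>{\<eta>\<in>V. k \<eta> = k \<xi>}. f \<eta>)" by (rule sum_nonneg) (use f in auto)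
  ultimately have "1 \<le> (w - (\<Sum>\<eta>\<in>{\<eta>\<in>V. k \<eta> < k \<xi>}. f \<eta>)) / (\<Sum>\<eta>\<in>{\<eta>\<in>V. k \<eta> = k \<xi>}. f \<eta>)"
    using le by (simp add: sum_level_split)
  then show ?thesis by (simp add: greedy_def)
qed

lemma greedy_takes_none:
  assumes f: "\<And>\<eta>. \<eta> \<in> V \<Longrightarrow> 0 \<le> f \<eta>"
    and ge: "w \<le> (\<Sum>\<eta>\<in>{\<eta>\<in>V. k \<eta> < k \<xi>}. f \<eta>)"
  shows "greedy V k w f \<xi> = 0"
proof -
  have "0 \<le> (\<Sum>\<eta>\<in>{\<eta>\<in>V. k \<eta> = k \<xi>}. f \<eta>)" by (rule sum_nonneg) (use f in auto)
  then have "(w - (\<Sum>\<eta>\<in>{\<eta>\<in>V. k \<eta> < k \<xi>}. f \<eta>)) / (\<Sum>\<eta>\<in>{\<eta>\<in>V. k \<eta> = k \<xi>}. f \<eta>) \<le> 0"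
    using ge by (simp add: divide_nonpos_nonneg)
  then show ?thesis by (simp add: greedy_def max_absorb1 min.coboundedI2)
qed

text \<open>
  If the supply grows, then less demand is open at the sphere of \<open>\<xi>\<close> and more supply competes for it,
  so the fraction taken from \<open>\<xi>\<close> falls while \<open>f \<xi>\<close> itself grows. Spheres without supply are a
  separate case because there the fraction has only a conventional value.
\<close>

lemma greedy_surplus_mono:
  assumes f: "\<And>\<eta>. \<eta> \<in> V \<Longrightarrow> 0 \<le> f \<eta>" and fg: "\<And>\<eta>. \<eta> \<in> V \<Longrightarrow> f \<eta> \<le> g \<eta>" and "\<xi> \<in> V"
  shows "f \<xi> - greedy V k w f \<xi> \<le> g \<xi> - greedy V k w g \<xi>"
proof -
  define t where "t h = w - (\<Sum>\<eta>\<in>{\<eta>\<in>V. k \<eta> < k \<xi>}. h \<eta>)" for h :: "'a \<Rightarrow> real"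
  define s where "s h = (\<Sum>\<eta>\<in>{\<eta>\<in>V. k \<eta> = k \<xi>}. h \<eta>)" for h :: "'a \<Rightarrow> real"
  define c where "c h = max 0 (min 1 (t h / s h))" for h
  have gr: "greedy V k w h \<xi> = h \<xi> * c h" for h by (simp add: greedy_def c_def s_def t_def)
  have c1: "c h \<le> 1" for h by (simp add: c_def)
  show ?thesis
  proof (cases "f \<xi> = 0")
    case True
    then show ?thesis
      using c1[of g] fg[OF \<open>\<xi> \<in> V\<close>] f[OF \<open>\<xi> \<in> V\<close>] by (simp add: gr mult_left_le)
  next
    case False
    then have "s f \<noteq> 0"
      using member_zero_of_sphere_zero[of f, OF f \<open>\<xi> \<in> V\<close>] unfolding s_def by auto
    moreover have "0 \<le> s f" unfolding s_def by (rule sum_nonneg) (use f in auto)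
    moreover have "s f \<le> s g" unfolding s_def by (rule sum_mono) (use fg in auto)
    moreover have "t g \<le> t f" unfolding t_def
      by (intro diff_left_mono sum_mono) (use fg in auto)
    ultimately have "c g \<le> c f"
    proof (cases "t g \<ge> 0")
      case True
      then have "t g / s g \<le> t f / s f"
        using \<open>s f \<noteq> 0\<close> \<open>0 \<le> s f\<close> \<open>s f \<le> s g\<close> \<open>t g \<le> t f\<close> by (intro frac_le) auto
      then show ?thesis unfolding c_def by (simp add: max_def min_def)
    next
      case False
      then have "t g / s g \<le> 0" using \<open>0 \<le> s f\<close> \<open>s f \<le> s g\<close> by (simp add: divide_nonpos_nonneg)
      then show ?thesis unfolding c_def by simp
    qed
    then have "f \<xi> * (1 - c f) \<le> g \<xi> * (1 - c g)"
      using c1[of f] c1[of g] f[OF \<open>\<xi> \<in> V\<close>] fg[OF \<open>\<xi> \<in> V\<close>] by (intro mult_mono) auto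
    then show ?thesis by (simp add: gr algebra_simps)
  qed
qed

text \<open>
  The recipe with a radius \<open>\<rho>\<close> and a constant \<open>c\<close> that is chosen to make the total equal to \<open>w\<close>
  produces the greedy share. Indeed the total determines \<open>c\<close> unless the sphere of radius \<open>\<rho>\<close> has no
  supply, and in that case the value of \<open>c\<close> has no influence on the share. The second part says that
  beyond \<open>\<rho>\<close> the demand is already met by the smaller spheres.
\<close>

lemma greedy_unique:
  fixes w :: real and f :: "'a \<Rightarrow> real"
  assumes f: "\<And>\<eta>. \<eta> \<in> V \<Longrightarrow> 0 \<le> f \<eta>" and w: "0 \<le> w"
  defines "\<rho> \<equiv> Inf {enat a |a. w \<le> (\<Sum>\<eta>\<in>{\<eta>\<in>V. k \<eta> \<le> a}. f \<eta>)}"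
  defines "taken \<equiv> \<lambda>c \<eta>. if enat (k \<eta>) < \<rho> then f \<eta> else if enat (k \<eta>) = \<rho> then (1 - c) * f \<eta> else 0"
  defines "P \<equiv> \<lambda>c. c \<in> {0..1} \<and> (\<Sum>\<^sub>\<infinity>\<eta>\<in>V. taken c \<eta>) = w"
  assumes "\<xi> \<in> V"
  shows "taken (SOME c. P c) \<xi> = greedy V k w f \<xi>"
    and "enat (k \<xi>) > \<rho> \<Longrightarrow> w \<le> (\<Sum>\<eta>\<in>{\<eta>\<in>V. k \<eta> < k \<xi>}. f \<eta>)"
proof -
  let ?S = "\<lambda>a. \<Sum>\<eta>\<in>{\<eta>\<in>V. k \<eta> \<le> a}. f \<eta>"
  have S_below: "?S a < w" if "enat a < \<rho>" for a
  proof (rule ccontr)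
    assume "\<not> ?S a < w"
    then have "\<rho> \<le> enat a" unfolding \<rho>_def by (intro Inf_lower) auto
    with that show False by simp
  qed
  have S_at: "w \<le> ?S a" if "\<rho> = enat a" for a
  proof -
    have "{enat a |a. w \<le> ?S a} \<noteq> {}"
    proof
      assume "{enat a |a. w \<le> ?S a} = {}"
      then have "\<rho> = \<infinity>" unfolding \<rho>_def by (simp only: Inf_enat_def simp_thms if_True)
      with that show False by simp
    qed
    then obtain b where "b \<in> {enat a |a. w \<le> ?S a}" by blast
    then have "\<rho> \<in> {enat a |a. w \<le> ?S a}" unfolding \<rho>_def by (rule wellorder_InfI)
    then show ?thesis using that by auto
  qed
  have beyond: "w \<le> (\<Sum>\<eta>\<in>{\<eta>\<in>V. k \<eta> < k \<xi>}. f \<eta>)" if gt: "enat (k \<xi>) > \<rho>"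
  proof -
    obtain a where a: "\<rho> = enat a" using gt by (cases \<rho>) auto
    have "?S a \<le> (\<Sum>\<eta>\<in>{\<eta>\<in>V. k \<eta> < k \<xi>}. f \<eta>)"
      by (rule sum_mono2) (use gt a f in auto)
    with S_at[OF a] show ?thesis by simp
  qed
  then show "enat (k \<xi>) > \<rho> \<Longrightarrow> w \<le> (\<Sum>\<eta>\<in>{\<eta>\<in>V. k \<eta> < k \<xi>}. f \<eta>)" .
  have inner: "greedy V k w f \<xi> = f \<xi>" if "enat (k \<xi>) < \<rho>"
    by (rule greedy_takes_all) (use f \<open>\<xi> \<in> V\<close> S_below[OF that] in auto)
  show "taken (SOME c. P c) \<xi> = greedy V k w f \<xi>"
  proof (cases "enat (k \<xi>) = \<rho>")
    case False
    consider "enat (k \<xi>) < \<rho>" | "enat (k \<xi>) > \<rho>" using False by fastforce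
    then show ?thesis
    proof cases
      case 1
      then show ?thesis using inner by (simp add: taken_def)
    next
      case 2
      then have "greedy V k w f \<xi> = 0" using greedy_takes_none[of f, OF f beyond] by auto
      then show ?thesis using 2 by (auto simp: taken_def)
    qed
  next
    case True
    define a where "a = k \<xi>"
    have \<rho>: "\<rho> = enat a" using True a_def by simp
    define lt where "lt = (\<Sum>\<eta>\<in>{\<eta>\<in>V. k \<eta> < a}. f \<eta>)"
    define eq where "eq = (\<Sum>\<eta>\<in>{\<eta>\<in>V. k \<eta> = a}. f \<eta>)"
    have total: "(\<Sum>\<^sub>\<infinity>\<eta>\<in>V. taken c \<eta>) = lt + (1 - c) * eq" for c
    proof -
      have "(\<Sum>\<^sub>\<infinity>\<eta>\<in>V. taken c \<eta>) = (\<Sum>\<^sub>\<infinity>\<eta>\<in>{\<eta>\<in>V. k \<eta> \<le> a}. taken c \<eta>)"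
        by (rule infsum_cong_neutral) (auto simp: taken_def \<rho>)
      also have "\<dots> = (\<Sum>\<eta>\<in>{\<eta>\<in>V. k \<eta> \<le> a}. taken c \<eta>)" using finite_level by simp
      also have "\<dots> = lt + (1 - c) * eq"
        unfolding sum_level_split lt_def eq_def sum_distrib_left
        by (intro arg_cong2[where f="(+)"] sum.cong) (auto simp: taken_def \<rho>)
      finally show ?thesis .
    qed
    have lt_le: "lt \<le> w"
    proof (cases a)
      case 0
      then show ?thesis using w by (simp add: lt_def)
    next
      case (Suc b)
      then have "{\<eta>\<in>V. k \<eta> < a} = {\<eta>\<in>V. k \<eta> \<le> b}" by auto
      then show ?thesis using S_below[of b] Suc \<rho> by (simp add: lt_def)
    qed
    have w_le: "w \<le> lt + eq" using S_at[OF \<rho>] by (simp add: sum_level_split lt_def eq_def)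
    have eq_nn: "0 \<le> eq" unfolding eq_def by (rule sum_nonneg) (use f in auto)
    \<comment> \<open>The total \<open>lt + (1 - c) * eq\<close> runs from \<open>lt + eq \<ge> w\<close> to \<open>lt \<le> w\<close>, so it attains \<open>w\<close>.\<close>
    have "P (if eq = 0 then 0 else 1 - (w - lt) / eq)"
      using lt_le w_le eq_nn by (auto simp: P_def total field_simps)
    then have "P (SOME c. P c)" by (rule someI)
    then have c: "(SOME c. P c) \<in> {0..1}" "(1 - (SOME c. P c)) * eq = w - lt"
      by (auto simp: P_def total)
    show ?thesis
    proof (cases "eq = 0")
      case True
      then have "f \<xi> = 0"
        using member_zero_of_sphere_zero[of f, OF f \<open>\<xi> \<in> V\<close>] by (simp add: eq_def a_def)
      then show ?thesis by (simp add: taken_def greedy_def)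
    next
      case False
      then have "1 - (SOME c. P c) = (w - lt) / eq" using c(2) by (simp add: field_simps)
      then show ?thesis
        using c(1) \<rho> by (simp add: taken_def greedy_def lt_def eq_def a_def)
    qed
  qed
qed

end

section \<open>Distances, balls and local isomorphisms\<close>
lemma adj_sym: "(u, v) \<in> adj G \<Longrightarrow> (v, u) \<in> adj G"
  by (auto simp: adj_def insert_commute)

lemma adj_relpow_sym: "(u, v) \<in> adj G ^^ n \<Longrightarrow> (v, u) \<in> adj G ^^ n"
proof (induction n arbitrary: v)
  case (Suc n)
  then obtain z where "(u, z) \<in> adj G ^^ n" "(z, v) \<in> adj G" by auto
  then show ?case using Suc.IH adj_sym by (meson relpow_Suc_I2)
qed auto

lemma gdist_sym: "gdist G u v = gdist G v u"
  unfolding gdist_def using adj_relpow_sym by (metis (mono_tags))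

lemma gdist_le: "(u, v) \<in> adj G ^^ n \<Longrightarrow> gdist G u v \<le> n"
  unfolding gdist_def by (rule Least_le)

lemma gdist_self [simp]: "gdist G u u = 0"
  using gdist_le[where u = u and v = u and n = 0] by simp

lemma ends_subset: "is_network G \<Longrightarrow> e \<in> edges G \<Longrightarrow> ends G e \<subseteq> verts G"
  unfolding is_network_def by force

lemma adj_verts: "is_network G \<Longrightarrow> (u, v) \<in> adj G \<Longrightarrow> u \<in> verts G \<and> v \<in> verts G"
  using ends_subset by (fastforce simp: adj_def)

lemma gdist_relpow:
  assumes "is_network G" "u \<in> verts G" "v \<in> verts G"
  shows "(u, v) \<in> adj G ^^ gdist G u v"
proof -
  have "(u, v) \<in> (adj G)\<^sup>*" using assms by (auto simp: is_network_def)
  then obtain n where "(u, v) \<in> adj G ^^ n" by (auto simp: rtrancl_power)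
  then show ?thesis unfolding gdist_def by (rule LeastI)
qed

lemma gdist_triangle:
  assumes "is_network G" "u \<in> verts G" "v \<in> verts G" "x \<in> verts G"
  shows "gdist G u x \<le> gdist G u v + gdist G v x"
  using relpow_trans[OF gdist_relpow[OF assms(1-3)] gdist_relpow[OF assms(1,3,4)]]
  by (rule gdist_le)

lemma gdist_triangle_le:
  assumes "is_network G" "u \<in> verts G" "v \<in> verts G" "x \<in> verts G" "gdist G v x \<le> n" "gdist G u v + n \<le> R"
  shows "gdist G u x \<le> R"
  using gdist_triangle[OF assms(1-4)] assms(5,6) by linarith

lemma finite_nbhd:
  assumes G: "is_network G" and "v \<in> verts G"
  shows "finite (nbhd G r v)"
proof (induction r)
  case 0
  have "nbhd G 0 v \<subseteq> {v}"
    using gdist_relpow[OF assms] by (fastforce simp: nbhd_def)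
  then show ?case by (rule finite_subset) simp
next
  case (Suc r)
  let ?N = "nbhd G r v"
  have "finite (ends G e)" if "e \<in> edges G" for e
    using G that unfolding is_network_def by force
  moreover have "finite {e\<in>edges G. z \<in> ends G e}" if "z \<in> ?N" for z
    using G that by (auto simp: is_network_def nbhd_def)
  ultimately have fin: "finite (?N \<union> (\<Union>z\<in>?N. \<Union>e\<in>{e\<in>edges G. z \<in> ends G e}. ends G e))"
    using Suc by auto
  have "x \<in> ?N \<union> (\<Union>z\<in>?N. \<Union>e\<in>{e\<in>edges G. z \<in> ends G e}. ends G e)"
    if x: "x \<in> nbhd G (Suc r) v" for x
  proof (cases "x \<in> ?N")
    case False
    then have d: "gdist G v x = Suc r" "x \<in> verts G" using x by (auto simp: nbhd_def)
    then obtain z where z: "(v, z) \<in> adj G ^^ r" "(z, x) \<in> adj G"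
      using gdist_relpow[OF assms, of x] by auto
    then have "z \<in> ?N" using gdist_le[OF z(1)] adj_verts[OF G z(2)] by (auto simp: nbhd_def)
    moreover obtain e where "e \<in> edges G" "ends G e = {z, x}" using z(2) by (auto simp: adj_def)
    ultimately show ?thesis by (intro UnI2) (rule UN_I[of z], auto)
  qed simp
  then show ?case using fin by (meson finite_subset subsetI)
qed

lemma nbhd_verts: "nbhd G r v \<subseteq> verts G"
  by (auto simp: nbhd_def)

text \<open>
  Induced subnetworks on arbitrary vertex sets contain both balls and whole networks, so that
  isomorphisms of balls and isomorphisms of networks are covered by the same lemmas.
\<close>

definition sub_net :: "'m network \<Rightarrow> nat set \<Rightarrow> 'm network" where
  "sub_net G N = G\<lparr>verts := N, edges := {e\<in>edges G. ends G e \<subseteq> N}\<rparr>"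

lemma sub_net_simps [simp]:
  "verts (sub_net G N) = N" "edges (sub_net G N) = {e\<in>edges G. ends G e \<subseteq> N}"
  "ends (sub_net G N) = ends G" "vmark (sub_net G N) = vmark G" "emark (sub_net G N) = emark G"
  by (auto simp: sub_net_def)

lemma ball_net_eq_sub_net: "ball_net G r v = sub_net G (nbhd G r v)"
  by (simp add: ball_net_def sub_net_def)

lemma sub_net_verts: "is_network G \<Longrightarrow> sub_net G (verts G) = G"
  using ends_subset by (fastforce simp: sub_net_def intro!: network.equality)

lemma graph_iso_inverse:
  assumes "graph_iso (sub_net G N) (sub_net H N') \<phi> \<psi>"
  shows "graph_iso (sub_net H N') (sub_net G N) (inv_into N \<phi>) (inv_into (edges (sub_net G N)) \<psi>)"
proof -
  let ?E = "{e\<in>edges G. ends G e \<subseteq> N}"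
  have b: "bij_betw \<phi> N N'" "bij_betw \<psi> ?E {e\<in>edges H. ends H e \<subseteq> N'}"
    and e: "\<And>e. e \<in> ?E \<Longrightarrow> ends H (\<psi> e) = \<phi> ` ends G e"
    using assms by (auto simp: graph_iso_def)
  have "ends G (inv_into ?E \<psi> e') = inv_into N \<phi> ` ends H e'"
    if "e' \<in> edges H" "ends H e' \<subseteq> N'" for e'
  proof -
    obtain e where *: "e \<in> ?E" "e' = \<psi> e" using b(2) \<open>e' \<in> edges H\<close> \<open>ends H e' \<subseteq> N'\<close>
      unfolding bij_betw_def by blast
    have "inv_into N \<phi> ` \<phi> ` ends G e = ends G e"
      using b(1) *(1) by (simp add: bij_betw_def inv_into_image_cancel)
    then show ?thesis using * e b(2) by (simp add: bij_betw_def)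
  qed
  then show ?thesis using b by (auto simp: graph_iso_def intro: bij_betw_inv_into)
qed

text \<open>
  A path of length at most \<open>r\<close> that starts at \<open>v\<close> stays in the ball of radius \<open>r\<close> about \<open>v\<close>, hence in
  \<open>N\<close>, so the isomorphism maps all its edges.
\<close>

lemma graph_iso_relpow:
  assumes G: "is_network G" and iso: "graph_iso (sub_net G N) (sub_net H N') \<phi> \<psi>"
    and v: "v \<in> verts G" and N: "nbhd G r v \<subseteq> N"
    and path: "(v, x) \<in> adj G ^^ n" and "n \<le> r"
  shows "(\<phi> v, \<phi> x) \<in> adj H ^^ n"
  using path \<open>n \<le> r\<close>
proof (induction n arbitrary: x)
  case (Suc n)
  then obtain z where z: "(v, z) \<in> adj G ^^ n" "(z, x) \<in> adj G" by auto
  have "(\<phi> v, \<phi> z) \<in> adj H ^^ n" using Suc z by simp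
  moreover have "(\<phi> z, \<phi> x) \<in> adj H"
  proof -
    obtain e where e: "e \<in> edges G" "ends G e = {z, x}" using z(2) by (auto simp: adj_def)
    have "gdist G v z \<le> r" "gdist G v x \<le> r"
      using gdist_le[OF z(1)] gdist_le[OF Suc.prems(1)] Suc.prems(2) by auto
    then have "z \<in> N" "x \<in> N"
      using N adj_verts[OF G z(2)] by (auto simp: nbhd_def)
    then have "e \<in> edges (sub_net G N)" using e by simp
    then have "\<psi> e \<in> edges H" "ends H (\<psi> e) = \<phi> ` ends G e"
      using iso by (fastforce simp: graph_iso_def bij_betw_def)+
    then show ?thesis using e(2) by (auto simp: adj_def intro!: bexI[of _ "\<psi> e"])
  qed
  ultimately show ?case by auto
qed auto

lemma graph_iso_gdist_le:
  assumes "is_network G" "graph_iso (sub_net G N) (sub_net H N') \<phi> \<psi>" "v \<in> verts G" "x \<in> verts G"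
    "nbhd G r v \<subseteq> N" "gdist G v x \<le> r"
  shows "gdist H (\<phi> v) (\<phi> x) \<le> gdist G v x"
  using graph_iso_relpow[OF assms(1-3,5) gdist_relpow[OF assms(1,3,4)] assms(6)] by (rule gdist_le)

lemma graph_iso_gdist:
  assumes G: "is_network G" and H: "is_network H"
    and iso: "graph_iso (sub_net G N) (sub_net H N') \<phi> \<psi>"
    and v: "v \<in> N" and x: "x \<in> N" and sub: "N \<subseteq> verts G" "N' \<subseteq> verts H"
    and N: "nbhd G r v \<subseteq> N" and N': "nbhd H r (\<phi> v) \<subseteq> N'"
  shows "gdist G v x \<le> r \<or> gdist H (\<phi> v) (\<phi> x) \<le> r \<Longrightarrow> gdist H (\<phi> v) (\<phi> x) = gdist G v x"
proof -
  have b: "bij_betw \<phi> N N'" using iso by (simp add: graph_iso_def)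
  note inv = graph_iso_inverse[OF iso]
  have im: "\<phi> v \<in> N'" "\<phi> x \<in> N'" "inv_into N \<phi> (\<phi> v) = v" "inv_into N \<phi> (\<phi> x) = x"
    using b v x by (auto simp: bij_betw_def)
  have "gdist G v x \<le> gdist H (\<phi> v) (\<phi> x)" if "gdist H (\<phi> v) (\<phi> x) \<le> r"
    using graph_iso_gdist_le[OF H inv _ _ N' that] im sub by auto
  moreover have "gdist H (\<phi> v) (\<phi> x) \<le> gdist G v x" if "gdist G v x \<le> r"
    using graph_iso_gdist_le[OF G iso _ _ N that] v x sub by auto
  ultimately show "gdist G v x \<le> r \<or> gdist H (\<phi> v) (\<phi> x) \<le> r \<Longrightarrow> gdist H (\<phi> v) (\<phi> x) = gdist G v x"
    by fastforce
qed

text \<open>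
  Distances from \<open>v\<close> up to \<open>r\<close> are realized by paths inside \<open>N\<close>, and distances from \<open>\<phi> v\<close> by paths
  inside \<open>N'\<close>. Both are therefore preserved, and the two balls of radius \<open>r\<close> correspond.
\<close>

lemma graph_iso_restrict:
  assumes G: "is_network G" and H: "is_network H"
    and iso: "graph_iso (sub_net G N) (sub_net H N') \<phi> \<psi>"
    and v: "v \<in> N" and sub: "N \<subseteq> verts G" "N' \<subseteq> verts H"
    and N: "nbhd G r v \<subseteq> N" and N': "nbhd H r (\<phi> v) \<subseteq> N'"
  shows "graph_iso (ball_net G r v) (ball_net H r (\<phi> v)) \<phi> \<psi>"
proof -
  let ?E = "{e\<in>edges G. ends G e \<subseteq> N}"
  have b: "bij_betw \<phi> N N'" "bij_betw \<psi> ?E {e\<in>edges H. ends H e \<subseteq> N'}"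
    and e: "\<And>e. e \<in> ?E \<Longrightarrow> ends H (\<psi> e) = \<phi> ` ends G e"
    using iso by (auto simp: graph_iso_def)
  note d = graph_iso_gdist[OF G H iso v _ sub N N']
  have mem: "\<phi> x \<in> nbhd H r (\<phi> v) \<longleftrightarrow> x \<in> nbhd G r v" if "x \<in> N" for x
    using d[OF that] that b(1) sub by (auto simp: nbhd_def bij_betw_def)
  have im: "\<phi> ` nbhd G r v = nbhd H r (\<phi> v)"
  proof (intro equalityI subsetI)
    fix y assume y: "y \<in> nbhd H r (\<phi> v)"
    then obtain x where "x \<in> N" "y = \<phi> x" using N' b(1) unfolding bij_betw_def by blast
    then show "y \<in> \<phi> ` nbhd G r v" using mem y by blast
  qed (use mem N in auto)
  have edge: "ends H (\<psi> e) \<subseteq> nbhd H r (\<phi> v) \<longleftrightarrow> ends G e \<subseteq> nbhd G r v" if "e \<in> ?E" for e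
    using e[OF that] mem that by fastforce
  have "bij_betw \<psi> {e\<in>edges G. ends G e \<subseteq> nbhd G r v} {e\<in>edges H. ends H e \<subseteq> nbhd H r (\<phi> v)}"
  proof (rule bij_betwI')
    show "\<psi> e = \<psi> e' \<longleftrightarrow> e = e'"
      if "e \<in> {e\<in>edges G. ends G e \<subseteq> nbhd G r v}" "e' \<in> {e\<in>edges G. ends G e \<subseteq> nbhd G r v}" for e e'
    proof -
      have "e \<in> ?E" "e' \<in> ?E" using that N by auto
      then show ?thesis using b(2) by (meson bij_betw_def inj_on_eq_iff)
    qed
    show "\<psi> e \<in> {e\<in>edges H. ends H e \<subseteq> nbhd H r (\<phi> v)}"
      if "e \<in> {e\<in>edges G. ends G e \<subseteq> nbhd G r v}" for e
    proof -
      have "e \<in> ?E" using that N by auto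
      then show ?thesis using edge[of e] that b(2) by (auto simp: bij_betw_def)
    qed
    show "\<exists>e\<in>{e\<in>edges G. ends G e \<subseteq> nbhd G r v}. e' = \<psi> e"
      if "e' \<in> {e\<in>edges H. ends H e \<subseteq> nbhd H r (\<phi> v)}" for e'
    proof -
      have "e' \<in> {e\<in>edges H. ends H e \<subseteq> N'}" using that N' by auto
      then obtain e where "e \<in> ?E" "e' = \<psi> e" using b(2) unfolding bij_betw_def by blast
      then show ?thesis using edge[of e] that by auto
    qed
  qed
  moreover have "bij_betw \<phi> (nbhd G r v) (nbhd H r (\<phi> v))"
    using bij_betw_subset[OF b(1) N im] .
  ultimately show ?thesis using e N by (auto simp: graph_iso_def ball_net_eq_sub_net)
qed

text \<open>
  Networks that are close about \<open>u\<close> are also close about any other vertex \<open>v\<close>; the price is that the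
  radius drops by the distance of the two vertices. This gives the continuity of re-rooting.
\<close>

lemma ball_iso_restrict:
  assumes G: "is_network G" and H: "is_network H" and p: "u \<in> verts G" "p \<in> verts H" "\<phi> u = p"
    and iso: "ball_iso \<epsilon> (ball_net G R u) (ball_net H R p) \<phi> \<psi>"
    and v: "v \<in> verts G" and R: "gdist G u v + r \<le> R" and \<epsilon>: "\<epsilon> \<le> \<delta>"
  shows "ball_iso \<delta> (ball_net G r v) (ball_net H r (\<phi> v)) \<phi> \<psi>"
    and "\<phi> v \<in> verts H" and "gdist H p (\<phi> v) = gdist G u v"
proof -
  have g: "graph_iso (sub_net G (nbhd G R u)) (sub_net H (nbhd H R p)) \<phi> \<psi>"
    using iso by (simp add: ball_iso_def ball_net_eq_sub_net)
  have vN: "v \<in> nbhd G R u" using v R by (simp add: nbhd_def)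
  then have \<phi>v: "\<phi> v \<in> nbhd H R p" using g by (auto simp: graph_iso_def bij_betw_def)
  then show "\<phi> v \<in> verts H" by (simp add: nbhd_def)
  have uN: "u \<in> nbhd G R u" using p by (simp add: nbhd_def)
  show d: "gdist H p (\<phi> v) = gdist G u v"
    using graph_iso_gdist[OF G H g uN vN nbhd_verts nbhd_verts, of R] p R by simp
  have N: "nbhd G r v \<subseteq> nbhd G R u" "nbhd H r (\<phi> v) \<subseteq> nbhd H R p"
    using gdist_triangle_le[OF G p(1) v _ _ R] gdist_triangle_le[OF H p(2) \<open>\<phi> v \<in> verts H\<close>, of _ r R] R d
    by (auto simp: nbhd_def)
  have "graph_iso (ball_net G r v) (ball_net H r (\<phi> v)) \<phi> \<psi>"
    by (rule graph_iso_restrict[OF G H g vN nbhd_verts nbhd_verts N])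
  moreover have "marks_rel (\<lambda>a b. dist a b < \<delta>) (ball_net G r v) (ball_net H r (\<phi> v)) \<phi> \<psi>"
  proof -
    have vm: "dist (vmark G x) (vmark H (\<phi> x)) < \<epsilon>" if "x \<in> nbhd G R u" for x
      using iso that by (auto simp: ball_iso_def marks_rel_def ball_net_eq_sub_net)
    have em: "dist (emark G x e) (emark H (\<phi> x) (\<psi> e)) < \<epsilon>"
      if "e \<in> edges G" "ends G e \<subseteq> nbhd G R u" "x \<in> ends G e" for x e
      using iso that by (auto simp: ball_iso_def marks_rel_def ball_net_eq_sub_net)
    show ?thesis
      unfolding marks_rel_def ball_net_eq_sub_net sub_net_simps
    proof (intro conjI ballI)
      show "dist (vmark G x) (vmark H (\<phi> x)) < \<delta>" if "x \<in> nbhd G r v" for x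
        using vm[of x] that N(1) \<epsilon> by fastforce
      show "dist (emark G x e) (emark H (\<phi> x) (\<psi> e)) < \<delta>"
        if "e \<in> {e\<in>edges G. ends G e \<subseteq> nbhd G r v}" "x \<in> ends G e" for e x
        using em[of e x] that N(1) \<epsilon> by fastforce
    qed
  qed
  ultimately show "ball_iso \<delta> (ball_net G r v) (ball_net H r (\<phi> v)) \<phi> \<psi>" by (simp add: ball_iso_def)
qed

lemma network_iso_gdist:
  assumes G: "is_network G" and H: "is_network H" and iso: "network_iso G H \<phi> \<psi>"
    and "u \<in> verts G" "v \<in> verts G"
  shows "gdist H (\<phi> u) (\<phi> v) = gdist G u v"
  by (rule graph_iso_gdist[OF G H, of "verts G" "verts H" \<phi> \<psi> _ _ "gdist G u v"])
    (use assms nbhd_verts in \<open>auto simp: network_iso_def sub_net_verts\<close>)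

lemma network_iso_vert: "network_iso G H \<phi> \<psi> \<Longrightarrow> v \<in> verts G \<Longrightarrow> \<phi> v \<in> verts H"
  by (auto simp: network_iso_def graph_iso_def bij_betw_def)

text \<open>
  Nearness of classes speaks of some representatives; by this lemma it can be tested on a given
  representative of the first class.
\<close>

lemma network_iso_ball_compose:
  assumes G: "is_network G" and G': "is_network G'" and iso: "network_iso G G' \<alpha> \<beta>" and u: "u \<in> verts G"
    and ball: "ball_iso \<epsilon> (ball_net G' r (\<alpha> u)) C \<phi> \<psi>"
  shows "ball_iso \<epsilon> (ball_net G r u) C (\<phi> \<circ> \<alpha>) (\<psi> \<circ> \<beta>)"
proof -
  have g: "graph_iso (ball_net G r u) (ball_net G' r (\<alpha> u)) \<alpha> \<beta>"
    by (rule graph_iso_restrict[OF G G', of "verts G" "verts G'"])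
      (use assms nbhd_verts in \<open>auto simp: network_iso_def sub_net_verts\<close>)
  have m: "marks_rel (=) (ball_net G r u) (ball_net G' r (\<alpha> u)) \<alpha> \<beta>"
    using iso nbhd_verts[of G r u] by (fastforce simp: network_iso_def marks_rel_def ball_net_eq_sub_net)
  have g': "graph_iso (ball_net G' r (\<alpha> u)) C \<phi> \<psi>"
    and m': "marks_rel (\<lambda>a b. dist a b < \<epsilon>) (ball_net G' r (\<alpha> u)) C \<phi> \<psi>"
    using ball by (auto simp: ball_iso_def)
  have bv: "\<alpha> x \<in> verts (ball_net G' r (\<alpha> u))" if "x \<in> verts (ball_net G r u)" for x
    using g that by (auto simp: graph_iso_def bij_betw_def)
  have be: "\<beta> e \<in> edges (ball_net G' r (\<alpha> u))" if "e \<in> edges (ball_net G r u)" for e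
    using g that unfolding graph_iso_def bij_betw_def by blast
  have "graph_iso (ball_net G r u) C (\<phi> \<circ> \<alpha>) (\<psi> \<circ> \<beta>)"
    using g g' be unfolding graph_iso_def by (auto intro: bij_betw_trans simp: image_comp)
  moreover have "marks_rel (\<lambda>a b. dist a b < \<epsilon>) (ball_net G r u) C (\<phi> \<circ> \<alpha>) (\<psi> \<circ> \<beta>)"
    unfolding marks_rel_def
  proof (intro conjI ballI)
    fix x assume x: "x \<in> verts (ball_net G r u)"
    then show "dist (vmark (ball_net G r u) x) (vmark C ((\<phi> \<circ> \<alpha>) x)) < \<epsilon>"
      using m m' bv[OF x] unfolding marks_rel_def by auto
  next
    fix e x assume e: "e \<in> edges (ball_net G r u)" and x: "x \<in> ends (ball_net G r u) e"
    have "\<alpha> x \<in> ends (ball_net G' r (\<alpha> u)) (\<beta> e)" using g e x by (auto simp: graph_iso_def)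
    then show "dist (emark (ball_net G r u) x e) (emark C ((\<phi> \<circ> \<alpha>) x) ((\<psi> \<circ> \<beta>) e)) < \<epsilon>"
      using m m' be[OF e] e x unfolding marks_rel_def by auto
  qed
  ultimately show ?thesis by (simp add: ball_iso_def)
qed

section \<open>Continuity of the maps between classes of networks\<close>
lemma rep_rnet_network:
  obtains G u where "rep_rnet x = (G, u)" "is_network G" "u \<in> verts G" "x = rcls G u"
proof -
  obtain G u where *: "rep_rnet x = (G, u)" by force
  have "rooted_iso (G, u) (G, u)" using Quotient3_rep_reflp[OF Quotient3_rnet, of x] * by simp
  moreover have "x = rcls G u" using Quotient3_abs_rep[OF Quotient3_rnet, of x] * by (simp add: rcls_def)
  ultimately show ?thesis using that * by (auto simp: rooted_iso_def)
qed

lemma rep_rnet_rcls: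
  assumes "is_network G" "u \<in> verts G"
  obtains H p \<phi> \<psi> where "rep_rnet (rcls G u) = (H, p)" "is_network H" "p \<in> verts H"
    "network_iso G H \<phi> \<psi>" "\<phi> u = p"
proof -
  obtain H p where H: "rep_rnet (rcls G u) = (H, p)" "is_network H" "p \<in> verts H" "rcls G u = rcls H p"
    using rep_rnet_network[of "rcls G u"] by metis
  then show ?thesis using that rcls_eq_iff[OF assms H(2,3)] by blast
qed

lemma rep_dnet_dcls:
  assumes "is_network G" "u \<in> verts G" "v \<in> verts G"
  obtains H p q \<phi> \<psi> where "rep_dnet (dcls G u v) = (H, p, q)" "is_network H" "p \<in> verts H" "q \<in> verts H"
    "network_iso G H \<phi> \<psi>" "\<phi> u = p" "\<phi> v = q"
proof -
  obtain H p q where *: "rep_dnet (dcls G u v) = (H, p, q)" by (metis prod_cases3)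
  have "drooted_iso (H, p, q) (H, p, q)"
    using Quotient3_rep_reflp[OF Quotient3_dnet, of "dcls G u v"] * by simp
  then have H: "is_network H" "p \<in> verts H" "q \<in> verts H" by (auto simp: drooted_iso_def)
  moreover have "dcls G u v = dcls H p q"
    using Quotient3_abs_rep[OF Quotient3_dnet, of "dcls G u v"] * by (simp add: dcls_def)
  ultimately show ?thesis using that * dcls_eq_iff[OF assms H] by blast
qed

definition fst_root :: "'m dnet \<Rightarrow> 'm rnet" where
  "fst_root y = (case rep_dnet y of (G, u, v) \<Rightarrow> rcls G u)"

definition flip :: "'m dnet \<Rightarrow> 'm dnet" where
  "flip y = (case rep_dnet y of (G, u, v) \<Rightarrow> dcls G v u)"

definition root_dist :: "'m dnet \<Rightarrow> nat" where
  "root_dist y = (case rep_dnet y of (G, u, v) \<Rightarrow> gdist G u v)"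

lemma dcls_projections:
  assumes "is_network G" "u \<in> verts G" "v \<in> verts G"
  shows fst_root_dcls: "fst_root (dcls G u v) = rcls G u"
    and flip_dcls: "flip (dcls G u v) = dcls G v u"
    and root_dist_dcls: "root_dist (dcls G u v) = gdist G u v"
proof -
  obtain H p q \<phi> \<psi> where rep: "rep_dnet (dcls G u v) = (H, p, q)"
    and H: "is_network H" "p \<in> verts H" "q \<in> verts H"
    and iso: "network_iso G H \<phi> \<psi>" "\<phi> u = p" "\<phi> v = q"
    using rep_dnet_dcls[OF assms] .
  show "fst_root (dcls G u v) = rcls G u" "flip (dcls G u v) = dcls G v u"
    using rcls_eq_iff[OF assms(1,2) H(1,2)] dcls_eq_iff[OF assms(1,3,2) H(1,3,2)] iso rep
    by (auto simp: fst_root_def flip_def)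
  show "root_dist (dcls G u v) = gdist G u v"
    using network_iso_gdist[OF assms(1) H(1) iso(1) assms(2,3)] iso rep by (simp add: root_dist_def)
qed

text \<open>
  Written as an integral against the counting measure, the sum inherits linearity and monotone
  convergence from the integral. It depends only on the class, so a chosen representative serves.
\<close>

definition vertex_sum :: "('m dnet \<Rightarrow> ennreal) \<Rightarrow> 'm rnet \<Rightarrow> ennreal" where
  "vertex_sum f x = (case rep_rnet x of (G, u) \<Rightarrow> \<integral>\<^sup>+v. f (dcls G u v) \<partial>count_space (verts G))"

lemma vertex_sum_rcls:
  assumes "is_network G" "u \<in> verts G"
  shows "vertex_sum f (rcls G u) = (\<integral>\<^sup>+v. f (dcls G u v) \<partial>count_space (verts G))"
proof -
  obtain H p \<phi> \<psi> where rep: "rep_rnet (rcls G u) = (H, p)" and H: "is_network H" "p \<in> verts H"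
    and iso: "network_iso G H \<phi> \<psi>" "\<phi> u = p"
    using rep_rnet_rcls[OF assms] .
  have "(\<integral>\<^sup>+v. f (dcls G u v) \<partial>count_space (verts G)) = (\<integral>\<^sup>+v. f (dcls H p (\<phi> v)) \<partial>count_space (verts G))"
  proof (rule nn_integral_cong)
    fix v assume "v \<in> space (count_space (verts G))"
    then have v: "v \<in> verts G" by simp
    show "f (dcls G u v) = f (dcls H p (\<phi> v))"
      using dcls_eq_iff[OF assms v H network_iso_vert[OF iso(1) v]] iso by metis
  qed
  also have "\<dots> = (\<integral>\<^sup>+v. f (dcls H p v) \<partial>count_space (verts H))"
    by (rule nn_integral_bij_count_space) (use iso in \<open>auto simp: network_iso_def graph_iso_def\<close>)
  finally show ?thesis by (simp add: vertex_sum_def rep)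
qed

lemma rnear_rclsE:
  assumes G: "is_network G" "u \<in> verts G" and "rnear r \<epsilon> (rcls G u) y"
  obtains H p \<phi> \<psi> where "is_network H" "p \<in> verts H" "y = rcls H p"
    "ball_iso \<epsilon> (ball_net G r u) (ball_net H r p) \<phi> \<psi>" "\<phi> u = p"
proof -
  obtain G' u' H p \<phi> \<psi> where G': "is_network G'" "u' \<in> verts G'" "rcls G u = rcls G' u'"
    and H: "is_network H" "p \<in> verts H" "y = rcls H p"
    and ball: "ball_iso \<epsilon> (ball_net G' r u') (ball_net H r p) \<phi> \<psi>" "\<phi> u' = p"
    using assms(3) unfolding rnear_def by blast
  obtain \<alpha> \<beta> where "network_iso G G' \<alpha> \<beta>" "\<alpha> u = u'"
    using rcls_eq_iff[OF G G'(1,2)] G'(3) by blast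
  then have "ball_iso \<epsilon> (ball_net G r u) (ball_net H r p) (\<phi> \<circ> \<alpha>) (\<psi> \<circ> \<beta>)" "(\<phi> \<circ> \<alpha>) u = p"
    using network_iso_ball_compose[OF G(1) G'(1)] G(2) ball by auto
  then show ?thesis using that H by blast
qed

lemma dnear_dclsE:
  assumes G: "is_network G" "u \<in> verts G" "v \<in> verts G" and "dnear r \<epsilon> (dcls G u v) y"
    and r: "gdist G u v \<le> r"
  obtains H p q \<phi> \<psi> where "is_network H" "p \<in> verts H" "q \<in> verts H" "y = dcls H p q"
    "ball_iso \<epsilon> (ball_net G r u) (ball_net H r p) \<phi> \<psi>" "\<phi> u = p" "\<phi> v = q"
proof -
  obtain G' u' v' H p q where G': "is_network G'" "u' \<in> verts G'" "v' \<in> verts G'" "dcls G u v = dcls G' u' v'"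
    and H: "is_network H" "p \<in> verts H" "q \<in> verts H" "y = dcls H p q"
    and near: "gdist G' u' v' \<le> r \<longrightarrow>
       (\<exists>\<phi> \<psi>. ball_iso \<epsilon> (ball_net G' r u') (ball_net H r p) \<phi> \<psi> \<and> \<phi> u' = p \<and> \<phi> v' = q)"
    using assms(4) unfolding dnear_def by blast
  obtain \<alpha> \<beta> where \<alpha>: "network_iso G G' \<alpha> \<beta>" "\<alpha> u = u'" "\<alpha> v = v'"
    using dcls_eq_iff[OF G G'(1-3)] G'(4) by blast
  have "gdist G' u' v' \<le> r" using network_iso_gdist[OF G(1) G'(1) \<alpha>(1) G(2,3)] \<alpha> r by simp
  then obtain \<phi> \<psi> where ball: "ball_iso \<epsilon> (ball_net G' r u') (ball_net H r p) \<phi> \<psi>" "\<phi> u' = p" "\<phi> v' = q"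
    using near by blast
  have "ball_iso \<epsilon> (ball_net G r u) (ball_net H r p) (\<phi> \<circ> \<alpha>) (\<psi> \<circ> \<beta>)"
    using network_iso_ball_compose[OF G(1) G'(1) \<alpha>(1) G(2)] ball \<alpha> by simp
  then show ?thesis using that H ball \<alpha> by (metis comp_apply)
qed

text \<open>
  To see the ball of radius \<open>r\<close> about the second root it is enough to see the ball about the first
  root whose radius is larger by the distance of the roots.
\<close>

lemma dconv_flip:
  assumes "dconv X x"
  shows "dconv (\<lambda>n. flip (X n)) (flip x)"
  unfolding dconv_def
proof (intro allI impI)
  fix r and \<epsilon> :: real assume "\<epsilon> > 0"
  obtain G u v where G: "is_network G" "u \<in> verts G" "v \<in> verts G" and x: "x = dcls G u v"
    using dnet_cases[of x] .
  have "\<forall>\<^sub>F n in sequentially. dnear (gdist G u v + r) \<epsilon> x (X n)"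
    using assms \<open>\<epsilon> > 0\<close> by (auto simp: dconv_def)
  then show "\<forall>\<^sub>F n in sequentially. dnear r \<epsilon> (flip x) (flip (X n))"
  proof eventually_elim
    case (elim n)
    then have "dnear (gdist G u v + r) \<epsilon> (dcls G u v) (X n)" by (simp add: x)
    then obtain H p q \<phi> \<psi> where H: "is_network H" "p \<in> verts H" "q \<in> verts H" "X n = dcls H p q"
      and ball: "ball_iso \<epsilon> (ball_net G (gdist G u v + r) u) (ball_net H (gdist G u v + r) p) \<phi> \<psi>"
        "\<phi> u = p" "\<phi> v = q"
      by (rule dnear_dclsE[OF G]) auto
    have "ball_iso \<epsilon> (ball_net G r v) (ball_net H r q) \<phi> \<psi>"
      using ball_iso_restrict(1)[OF G(1) H(1) G(2) H(2) ball(2,1) G(3), of r \<epsilon>] ball(3) by simp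
    then have "dnear r \<epsilon> (dcls G v u) (dcls H q p)"
      unfolding dnear_def using G H ball by blast
    then show ?case using G H x by (simp add: flip_dcls)
  qed
qed

lemma rconv_fst_root:
  assumes "dconv X x"
  shows "rconv (\<lambda>n. fst_root (X n)) (fst_root x)"
  unfolding rconv_def
proof (intro allI impI)
  fix r and \<epsilon> :: real assume "\<epsilon> > 0"
  obtain G u v where G: "is_network G" "u \<in> verts G" "v \<in> verts G" and x: "x = dcls G u v"
    using dnet_cases[of x] .
  have "\<forall>\<^sub>F n in sequentially. dnear (gdist G u v + r) \<epsilon> x (X n)"
    using assms \<open>\<epsilon> > 0\<close> by (auto simp: dconv_def)
  then show "\<forall>\<^sub>F n in sequentially. rnear r \<epsilon> (fst_root x) (fst_root (X n))"
  proof eventually_elim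
    case (elim n)
    then have "dnear (gdist G u v + r) \<epsilon> (dcls G u v) (X n)" by (simp add: x)
    then obtain H p q \<phi> \<psi> where H: "is_network H" "p \<in> verts H" "q \<in> verts H" "X n = dcls H p q"
      and ball: "ball_iso \<epsilon> (ball_net G (gdist G u v + r) u) (ball_net H (gdist G u v + r) p) \<phi> \<psi>"
        "\<phi> u = p" "\<phi> v = q"
      by (rule dnear_dclsE[OF G]) auto
    have "ball_iso \<epsilon> (ball_net G r u) (ball_net H r p) \<phi> \<psi>"
      using ball_iso_restrict(1)[OF G(1) H(1) G(2) H(2) ball(2,1) G(2), of r \<epsilon>] ball(2) by simp
    then have "rnear r \<epsilon> (rcls G u) (rcls H p)"
      unfolding rnear_def using G H ball by blast
    then show ?case using G H x by (simp add: fst_root_dcls)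
  qed
qed

lemma measurable_flip [measurable]: "flip \<in> borel_measurable borel"
proof (rule borel_measurableI)
  fix U :: "'a dnet set" assume U: "open U"
  have "open (flip -` U)"
    unfolding open_dnet_def
  proof (intro allI ballI impI)
    fix X and x :: "'a dnet" assume "x \<in> flip -` U" "dconv X x"
    then show "\<forall>\<^sub>F n in sequentially. X n \<in> flip -` U"
      using U dconv_flip[of X x] unfolding open_dnet_def by force
  qed
  then show "flip -` U \<inter> space borel \<in> sets borel" by simp
qed

lemma measurable_fst_root [measurable]: "fst_root \<in> borel_measurable borel"
proof (rule borel_measurableI)
  fix U :: "'a rnet set" assume U: "open U"
  have "open (fst_root -` U)"
    unfolding open_dnet_def
  proof (intro allI ballI impI)
    fix X and x :: "'a dnet" assume "x \<in> fst_root -` U" "dconv X x"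
    then show "\<forall>\<^sub>F n in sequentially. X n \<in> fst_root -` U"
      using U rconv_fst_root[of X x] unfolding open_rnet_def by force
  qed
  then show "fst_root -` U \<inter> space borel \<in> sets borel" by simp
qed

text \<open>
  An isomorphism of balls of radius \<open>k\<close> about the first roots preserves the distance of the second
  root from the first one, so the distance is locally constant where it is at most \<open>k\<close>.
\<close>

lemma open_root_dist_le: "open {y :: 'm::metric_space dnet. root_dist y \<le> k}"
  unfolding open_dnet_def
proof (intro allI ballI impI)
  fix X and x :: "'m dnet" assume x: "x \<in> {y. root_dist y \<le> k}" and conv: "dconv X x"
  obtain G u v where G: "is_network G" "u \<in> verts G" "v \<in> verts G" and xc: "x = dcls G u v"
    using dnet_cases[of x] .
  then have k: "gdist G u v \<le> k" using x by (simp add: root_dist_dcls)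
  have "\<forall>\<^sub>F n in sequentially. dnear k 1 x (X n)"
    using conv by (auto simp: dconv_def)
  then show "\<forall>\<^sub>F n in sequentially. X n \<in> {y. root_dist y \<le> k}"
  proof eventually_elim
    case (elim n)
    then have "dnear k 1 (dcls G u v) (X n)" by (simp add: xc)
    then obtain H p q \<phi> \<psi> where H: "is_network H" "p \<in> verts H" "q \<in> verts H" "X n = dcls H p q"
      and ball: "ball_iso 1 (ball_net G k u) (ball_net H k p) \<phi> \<psi>" "\<phi> u = p" "\<phi> v = q"
      using dnear_dclsE[OF G _ k] by metis
    have "gdist H p q \<le> k"
      using ball_iso_restrict(3)[OF G(1) H(1) G(2) H(2) ball(2,1) G(3), of 0 1] ball(3) k by simp
    then show ?case using H by (simp add: root_dist_dcls)
  qed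
qed

lemma measurable_root_dist [measurable]:
  "(root_dist :: 'm::metric_space dnet \<Rightarrow> nat) \<in> measurable borel (count_space UNIV)"
proof (rule measurable_count_space_eq2_countable[THEN iffD2], intro conjI ballI)
  fix k
  have le: "{y :: 'm dnet. root_dist y \<le> j} \<in> sets borel" for j
    by (rule borel_open[OF open_root_dist_le])
  have "root_dist -` {k} \<inter> space borel =
      {y :: 'm dnet. root_dist y \<le> k} - (if k = 0 then {} else {y. root_dist y \<le> k - 1})"
    by auto
  also have "\<dots> \<in> sets borel" using le by (intro sets.Diff) auto
  finally show "(root_dist :: 'm dnet \<Rightarrow> nat) -` {k} \<inter> space borel \<in> sets borel" .
qed auto

text \<open>
  One scale \<open>K n\<close> that tends to infinity and serves both as radius and as inverse precision replaces
  the two quantifiers in the definition of convergence. It is the largest scale up to \<open>n\<close> at which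
  \<open>X n\<close> is near the limit.
\<close>

lemma rconv_diagonal:
  fixes X :: "nat \<Rightarrow> 'm::metric_space rnet"
  assumes "rconv X x"
  obtains K where "\<And>m. \<forall>\<^sub>F n in sequentially. m \<le> K n"
    "\<forall>\<^sub>F n in sequentially. rnear (K n) (1 / (real (K n) + 1)) x (X n)"
proof -
  define K where "K n = (GREATEST m. m \<le> n \<and> (m = 0 \<or> rnear m (1 / (real m + 1)) x (X n)))" for n
  have K: "K n \<le> n \<and> (K n = 0 \<or> rnear (K n) (1 / (real (K n) + 1)) x (X n))" for n
    unfolding K_def by (rule GreatestI_nat[of _ 0 n]) auto
  have large: "\<forall>\<^sub>F n in sequentially. m \<le> K n" for m
  proof -
    have "\<forall>\<^sub>F n in sequentially. rnear m (1 / (real m + 1)) x (X n)"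
      using assms by (auto simp: rconv_def)
    then show ?thesis using eventually_ge_at_top[of m]
    proof eventually_elim
      case (elim n)
      then show ?case unfolding K_def by (intro Greatest_le_nat[of _ _ n]) auto
    qed
  qed
  have "\<forall>\<^sub>F n in sequentially. rnear (K n) (1 / (real (K n) + 1)) x (X n)"
    using large[of 1]
  proof eventually_elim
    case (elim n)
    then show ?case using K[of n] by auto
  qed
  then show ?thesis using that large by blast
qed

text \<open>
  Each vertex \<open>v\<close> of the limit is followed along the sequence by the local isomorphisms \<open>\<phi> n\<close> at the
  diagonal scale. The images in \<open>X n\<close> converge to \<open>v\<close> as second roots, and distinct vertices of a ball
  eventually have distinct images.
\<close>

lemma rconv_vertices:
  fixes X :: "nat \<Rightarrow> 'm::metric_space rnet"
  assumes G: "is_network G" "u \<in> verts G" and conv: "rconv X (rcls G u)"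
  obtains H p \<phi> where "\<forall>\<^sub>F n in sequentially. is_network (H n) \<and> p n \<in> verts (H n) \<and> X n = rcls (H n) (p n)"
    "\<And>k. \<forall>\<^sub>F n in sequentially. inj_on (\<phi> n) (nbhd G k u) \<and> \<phi> n ` nbhd G k u \<subseteq> verts (H n)"
    "\<And>v. v \<in> verts G \<Longrightarrow> dconv (\<lambda>n. dcls (H n) (p n) (\<phi> n v)) (dcls G u v)"
proof -
  obtain K where K: "\<And>m. \<forall>\<^sub>F n in sequentially. m \<le> K n"
    "\<forall>\<^sub>F n in sequentially. rnear (K n) (1 / (real (K n) + 1)) (rcls G u) (X n)"
    using rconv_diagonal[OF conv] by blast
  let ?Q = "\<lambda>n (H, p, \<phi>, \<psi>). is_network H \<and> p \<in> verts H \<and> X n = rcls H p \<and>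
      ball_iso (1 / (real (K n) + 1)) (ball_net G (K n) u) (ball_net H (K n) p) \<phi> \<psi> \<and> \<phi> u = p"
  have "\<exists>z. rnear (K n) (1 / (real (K n) + 1)) (rcls G u) (X n) \<longrightarrow> ?Q n z" for n
  proof (cases "rnear (K n) (1 / (real (K n) + 1)) (rcls G u) (X n)")
    case True
    then obtain H p \<phi> \<psi> where "?Q n (H, p, \<phi>, \<psi>)"
      by (rule rnear_rclsE[OF G]) auto
    then show ?thesis by blast
  qed blast
  then have "\<exists>Z. \<forall>n. rnear (K n) (1 / (real (K n) + 1)) (rcls G u) (X n) \<longrightarrow> ?Q n (Z n)"
    by (intro choice allI)
  then obtain Z where Z: "\<And>n. rnear (K n) (1 / (real (K n) + 1)) (rcls G u) (X n) \<Longrightarrow> ?Q n (Z n)"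
    by blast
  define H p \<phi> \<psi> where "H n = fst (Z n)" and "p n = fst (snd (Z n))"
    and "\<phi> n = fst (snd (snd (Z n)))" and "\<psi> n = snd (snd (snd (Z n)))" for n
  have good: "\<forall>\<^sub>F n in sequentially. is_network (H n) \<and> p n \<in> verts (H n) \<and> X n = rcls (H n) (p n) \<and>
      ball_iso (1 / (real (K n) + 1)) (ball_net G (K n) u) (ball_net (H n) (K n) (p n)) (\<phi> n) (\<psi> n) \<and> \<phi> n u = p n"
    using K(2)
  proof eventually_elim
    case (elim n)
    then show ?case using Z[of n] by (simp add: H_def p_def \<phi>_def \<psi>_def case_prod_beta)
  qed
  have inj: "\<forall>\<^sub>F n in sequentially. inj_on (\<phi> n) (nbhd G k u) \<and> \<phi> n ` nbhd G k u \<subseteq> verts (H n)" for k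
    using good K(1)[of k]
  proof eventually_elim
    case (elim n)
    then have "bij_betw (\<phi> n) (nbhd G (K n) u) (nbhd (H n) (K n) (p n))"
      by (auto simp: ball_iso_def graph_iso_def ball_net_eq_sub_net)
    moreover have "nbhd G k u \<subseteq> nbhd G (K n) u" using elim by (auto simp: nbhd_def)
    ultimately show ?case using nbhd_verts[of "H n" "K n" "p n"] unfolding bij_betw_def by (blast intro: inj_on_subset)
  qed
  have "dconv (\<lambda>n. dcls (H n) (p n) (\<phi> n v)) (dcls G u v)" if v: "v \<in> verts G" for v
    unfolding dconv_def
  proof (intro allI impI)
    fix r and \<epsilon> :: real assume "\<epsilon> > 0"
    obtain m where m: "1 / (real m + 1) < \<epsilon>"
      using nat_approx_posE[OF \<open>\<epsilon> > 0\<close>] by (metis Suc_eq_plus1 of_nat_Suc add.commute)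
    show "\<forall>\<^sub>F n in sequentially. dnear r \<epsilon> (dcls G u v) (dcls (H n) (p n) (\<phi> n v))"
      using good K(1)[of r] K(1)[of m] K(1)[of "gdist G u v"]
    proof eventually_elim
      case (elim n)
      then have n: "is_network (H n)" "p n \<in> verts (H n)" "\<phi> n u = p n"
        "ball_iso (1 / (real (K n) + 1)) (ball_net G (K n) u) (ball_net (H n) (K n) (p n)) (\<phi> n) (\<psi> n)"
        by auto
      have "1 / (real (K n) + 1) \<le> 1 / (real m + 1)" using elim by (intro divide_left_mono) auto
      then have "1 / (real (K n) + 1) \<le> \<epsilon>" using m by linarith
      then have "ball_iso \<epsilon> (ball_net G r u) (ball_net (H n) r (p n)) (\<phi> n) (\<psi> n)"
        using ball_iso_restrict(1)[OF G(1) n(1) G(2) n(2-4) G(2), of r \<epsilon>] n(3) elim by simp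
      moreover have "\<phi> n v \<in> verts (H n)"
        using ball_iso_restrict(2)[OF G(1) n(1) G(2) n(2-4) v _ order_refl, of 0] elim by simp
      ultimately show ?case unfolding dnear_def using G v n by blast
    qed
  qed
  then show ?thesis using that[of H p \<phi>] good inj by (simp add: eventually_conj_iff)
qed

section \<open>Sums over the vertices are Borel functions\<close>
lemma vertex_sum_indicator:
  assumes "is_network G" "u \<in> verts G"
  shows "vertex_sum (indicator A) (rcls G u) = emeasure (count_space (verts G)) {v\<in>verts G. dcls G u v \<in> A}"
proof -
  have "(\<integral>\<^sup>+v. indicator A (dcls G u v) \<partial>count_space (verts G)) =
      (\<integral>\<^sup>+v. indicator {v\<in>verts G. dcls G u v \<in> A} v \<partial>count_space (verts G))"
    by (rule nn_integral_cong) (auto simp: indicator_def)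
  then show ?thesis using assms by (simp add: vertex_sum_rcls)
qed

text \<open>
  Restricting to pairs of roots at distance at most \<open>k\<close> makes all counts finite, so that counts of
  complements are differences. Openness of these sets keeps the restriction compatible with lower
  semicontinuity.
\<close>

abbreviation near_pairs :: "nat \<Rightarrow> 'm dnet set" where
  "near_pairs k \<equiv> {y. root_dist y \<le> k}"

lemma finite_near_vertices:
  assumes "is_network G" "u \<in> verts G"
  shows "finite {v\<in>verts G. dcls G u v \<in> A \<inter> near_pairs k}"
  by (rule finite_subset[OF _ finite_nbhd[OF assms, of k]]) (use assms in \<open>auto simp: nbhd_def root_dist_dcls\<close>)

text \<open>
  The count is lower semicontinuous: finitely many vertices \<open>v\<close> of the limit with \<open>[G,u,v]\<close> in the
  open set are followed along the sequence, and they eventually give equally many distinct vertices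
  whose doubly-rooted networks lie in that set.
\<close>

lemma measurable_vertex_count_open:
  assumes U: "open (U :: 'm::metric_space dnet set)"
  shows "vertex_sum (indicator (U \<inter> near_pairs k)) \<in> borel_measurable borel"
proof (rule borel_measurableI_greater)
  fix y :: ennreal
  let ?f = "vertex_sum (indicator (U \<inter> near_pairs k)) :: 'm rnet \<Rightarrow> ennreal"
  have V: "open (U \<inter> near_pairs k)" using U open_root_dist_le by (rule open_Int)
  have "open {x. y < ?f x}"
    unfolding open_rnet_def
  proof (intro allI ballI impI)
    fix X and x :: "'m rnet" assume x: "x \<in> {x. y < ?f x}" and conv: "rconv X x"
    obtain G u where G: "is_network G" "u \<in> verts G" and xc: "x = rcls G u" using rnet_cases[of x] .
    define N where "N = {v\<in>verts G. dcls G u v \<in> U \<inter> near_pairs k}"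
    have finN: "finite N" unfolding N_def using finite_near_vertices[OF G] .
    have NB: "N \<subseteq> nbhd G k u" using G by (auto simp: N_def nbhd_def root_dist_dcls)
    have y: "y < of_nat (card N)"
      using x finN unfolding xc by (simp add: vertex_sum_indicator[OF G] N_def)
    have "rconv X (rcls G u)" using conv by (simp add: xc)
    then obtain H p \<phi> where
      H: "\<forall>\<^sub>F n in sequentially. is_network (H n) \<and> p n \<in> verts (H n) \<and> X n = rcls (H n) (p n)"
      and inj: "\<And>k. \<forall>\<^sub>F n in sequentially. inj_on (\<phi> n) (nbhd G k u) \<and> \<phi> n ` nbhd G k u \<subseteq> verts (H n)"
      and lim: "\<And>v. v \<in> verts G \<Longrightarrow> dconv (\<lambda>n. dcls (H n) (p n) (\<phi> n v)) (dcls G u v)"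
      by (rule rconv_vertices[OF G]) blast
    have "\<forall>\<^sub>F n in sequentially. \<forall>v\<in>N. dcls (H n) (p n) (\<phi> n v) \<in> U \<inter> near_pairs k"
    proof (intro eventually_ball_finite[OF finN] ballI)
      fix v assume "v \<in> N"
      then show "\<forall>\<^sub>F n in sequentially. dcls (H n) (p n) (\<phi> n v) \<in> U \<inter> near_pairs k"
        using V lim[of v] unfolding open_dnet_def N_def by blast
    qed
    then show "\<forall>\<^sub>F n in sequentially. X n \<in> {x. y < ?f x}"
      using H inj[of k]
    proof eventually_elim
      case (elim n)
      then have n: "is_network (H n)" "p n \<in> verts (H n)" "X n = rcls (H n) (p n)" by auto
      let ?N' = "{v\<in>verts (H n). dcls (H n) (p n) v \<in> U \<inter> near_pairs k}"
      have inj_n: "inj_on (\<phi> n) (nbhd G k u)" and "\<phi> n ` nbhd G k u \<subseteq> verts (H n)"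
        using elim(3) by auto
      then have vert: "\<phi> n v \<in> verts (H n)" if "v \<in> N" for v using NB that by auto
      have sub: "\<phi> n ` N \<subseteq> ?N'"
      proof (rule image_subsetI)
        fix v assume "v \<in> N"
        with elim(1) vert[OF this] show "\<phi> n v \<in> ?N'" by (simp only: mem_Collect_eq simp_thms)
      qed
      have "card N \<le> card ?N'"
        using card_mono[OF finite_near_vertices[OF n(1,2)] sub] card_image[OF inj_on_subset[OF inj_n NB]]
        by (simp only:)
      then have "(of_nat (card N) :: ennreal) \<le> of_nat (card ?N')" by (rule of_nat_mono)
      also have "\<dots> = ?f (X n)"
        unfolding n(3) vertex_sum_indicator[OF n(1,2)]
        by (rule emeasure_count_space_finite[symmetric]) (use finite_near_vertices[OF n(1,2)] in auto)
      finally show ?case using y by simp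
    qed
  qed
  then show "{x \<in> space borel. y < ?f x} \<in> sets borel" by simp
qed

text \<open>
  Open sets are stable under intersection, and the sets with a measurable count form a Dynkin
  system.
\<close>

lemma measurable_vertex_count_near:
  assumes "A \<in> sets (borel :: 'm::metric_space dnet measure)"
  shows "vertex_sum (indicator (A \<inter> near_pairs k)) \<in> borel_measurable borel"
proof -
  have "Int_stable {S :: 'm dnet set. open S}" "{S :: 'm dnet set. open S} \<subseteq> Pow UNIV"
    "A \<in> sigma_sets UNIV {S. open S}"
    using assms by (auto simp: borel_def Int_stable_def)
  then show ?thesis
  proof (induction A rule: sigma_sets_induct_disjoint)
    case (basic A)
    then show ?case using measurable_vertex_count_open by blast
  next
    case empty
    have "vertex_sum (indicator ({} \<inter> near_pairs k)) = (\<lambda>x :: 'm rnet. 0)"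
    proof
      fix x :: "'m rnet"
      obtain G u where "is_network G" "u \<in> verts G" "x = rcls G u" using rnet_cases[of x] .
      then show "vertex_sum (indicator ({} \<inter> near_pairs k)) x = 0" by (simp add: vertex_sum_indicator)
    qed
    then show ?case by (simp only: borel_measurable_const)
  next
    case (compl A)
    have "vertex_sum (indicator ((UNIV - A) \<inter> near_pairs k)) =
        (\<lambda>x. vertex_sum (indicator (UNIV \<inter> near_pairs k)) x - vertex_sum (indicator (A \<inter> near_pairs k)) x)"
    proof
      fix x :: "'m rnet"
      obtain G u where G: "is_network G" "u \<in> verts G" and x: "x = rcls G u" using rnet_cases[of x] .
      let ?N = "\<lambda>A. {v\<in>verts G. dcls G u v \<in> A \<inter> near_pairs k}"
      have "?N (UNIV - A) = ?N UNIV - ?N A" by auto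
      then have "emeasure (count_space (verts G)) (?N (UNIV - A)) =
          emeasure (count_space (verts G)) (?N UNIV) - emeasure (count_space (verts G)) (?N A)"
        using finite_near_vertices[OF G, of A k]
        by (simp only:) (rule emeasure_Diff, auto simp: emeasure_count_space_finite simp del: Int_iff)
      then show "vertex_sum (indicator ((UNIV - A) \<inter> near_pairs k)) x =
          vertex_sum (indicator (UNIV \<inter> near_pairs k)) x - vertex_sum (indicator (A \<inter> near_pairs k)) x"
        unfolding x vertex_sum_indicator[OF G] .
    qed
    then show ?case
      using borel_measurable_minus_ennreal[OF measurable_vertex_count_open[OF open_UNIV] compl(2)] by (simp only:)
  next
    case (union A)
    have "vertex_sum (indicator ((\<Union>i. A i) \<inter> near_pairs k)) =
        (\<lambda>x. \<Sum>i. vertex_sum (indicator (A i \<inter> near_pairs k)) x)"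
    proof
      fix x :: "'m rnet"
      obtain G u where G: "is_network G" "u \<in> verts G" and x: "x = rcls G u" using rnet_cases[of x] .
      let ?N = "\<lambda>A. {v\<in>verts G. dcls G u v \<in> A \<inter> near_pairs k}"
      have "?N (\<Union>i. A i) = (\<Union>i. ?N (A i))" by auto
      moreover have "disjoint_family (\<lambda>i. ?N (A i))"
        using union(1) unfolding disjoint_family_on_def by blast
      ultimately have "emeasure (count_space (verts G)) (?N (\<Union>i. A i)) =
          (\<Sum>i. emeasure (count_space (verts G)) (?N (A i)))"
        by (subst suminf_emeasure) auto
      then show "vertex_sum (indicator ((\<Union>i. A i) \<inter> near_pairs k)) x =
          (\<Sum>i. vertex_sum (indicator (A i \<inter> near_pairs k)) x)"
        unfolding x vertex_sum_indicator[OF G] .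
    qed
    moreover have "vertex_sum (indicator (A i \<inter> near_pairs k)) \<in> borel_measurable borel" for i
      using union by blast
    ultimately show ?case by simp
  qed
qed

lemma vertex_sum_SUP:
  assumes "incseq U" "\<And>y. f y = (SUP i. U i y)"
  shows "vertex_sum f = (\<lambda>x. SUP i. vertex_sum (U i) x)"
proof
  fix x :: "'a rnet"
  obtain G u where G: "is_network G" "u \<in> verts G" and x: "x = rcls G u" using rnet_cases[of x] .
  show "vertex_sum f x = (SUP i. vertex_sum (U i) x)"
    unfolding x vertex_sum_rcls[OF G] assms(2)
    by (rule nn_integral_monotone_convergence_SUP) (use assms(1) in \<open>auto simp: incseq_def le_fun_def\<close>)
qed

lemma measurable_vertex_sum:
  fixes f :: "'m::metric_space dnet \<Rightarrow> ennreal"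
  assumes "f \<in> borel_measurable borel"
  shows "vertex_sum f \<in> borel_measurable borel"
  using assms
proof (induction rule: borel_measurable_induct)
  case (cong f g)
  then have "f = g" by auto
  then show ?case using cong by simp
next
  case (set A)
  have "vertex_sum (indicator A) = (\<lambda>x. SUP k. vertex_sum (indicator (A \<inter> near_pairs k)) x)"
  proof (rule vertex_sum_SUP)
    show "incseq (\<lambda>k. indicator (A \<inter> near_pairs k) :: _ \<Rightarrow> ennreal)"
      by (auto simp: incseq_def le_fun_def indicator_def)
    show "(indicator A y :: ennreal) = (SUP k. indicator (A \<inter> near_pairs k) y)" for y
    proof (rule antisym)
      show "(indicator A y :: ennreal) \<le> (SUP k. indicator (A \<inter> near_pairs k) y)"
        by (rule SUP_upper2[of "root_dist y"]) (auto simp: indicator_def)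
      show "(SUP k. indicator (A \<inter> near_pairs k) y) \<le> (indicator A y :: ennreal)"
        by (rule SUP_least) (auto simp: indicator_def)
    qed
  qed
  then show ?case using measurable_vertex_count_near[OF set] by simp
next
  case (mult f c)
  have "vertex_sum (\<lambda>y. c * f y) = (\<lambda>x. c * vertex_sum f x)"
  proof
    fix x :: "'m rnet"
    obtain G u where G: "is_network G" "u \<in> verts G" and x: "x = rcls G u" using rnet_cases[of x] .
    show "vertex_sum (\<lambda>y. c * f y) x = c * vertex_sum f x"
      unfolding x vertex_sum_rcls[OF G] by (simp add: nn_integral_cmult)
  qed
  then show ?case using mult by simp
next
  case (add f g)
  have "vertex_sum (\<lambda>y. g y + f y) = (\<lambda>x. vertex_sum g x + vertex_sum f x)"
  proof
    fix x :: "'m rnet"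
    obtain G u where G: "is_network G" "u \<in> verts G" and x: "x = rcls G u" using rnet_cases[of x] .
    show "vertex_sum (\<lambda>y. g y + f y) x = vertex_sum g x + vertex_sum f x"
      unfolding x vertex_sum_rcls[OF G] by (simp add: nn_integral_add)
  qed
  then show ?case using add by simp
next
  case (seq U)
  have "vertex_sum (\<lambda>y. SUP i. U i y) = (\<lambda>x. SUP i. vertex_sum (U i) x)"
    by (rule vertex_sum_SUP) (use seq in auto)
  then show ?case using seq by (simp add: image_comp SUP_apply[abs_def])
qed

text \<open>
  Factoring through the space of classes expresses isomorphism invariance and Borel measurability at
  once. Hence the stages of the algorithm, which are defined on representatives, need no separate
  proof of invariance.
\<close>

definition measurable_kernel :: "('m::metric_space network \<Rightarrow> nat \<Rightarrow> nat \<Rightarrow> real) \<Rightarrow> bool" where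
  "measurable_kernel f \<longleftrightarrow> (\<exists>h\<in>borel_measurable borel.
     \<forall>G. is_network G \<longrightarrow> (\<forall>u\<in>verts G. \<forall>v\<in>verts G. f G u v = h (dcls G u v)))"

lemma measurable_kernelI:
  assumes "h \<in> borel_measurable borel"
    "\<And>G u v. is_network G \<Longrightarrow> u \<in> verts G \<Longrightarrow> v \<in> verts G \<Longrightarrow> f G u v = h (dcls G u v)"
  shows "measurable_kernel f"
  using assms unfolding measurable_kernel_def by blast

lemma measurable_kernelE:
  assumes "measurable_kernel f"
  obtains h where "h \<in> borel_measurable borel"
    "\<And>G u v. is_network G \<Longrightarrow> u \<in> verts G \<Longrightarrow> v \<in> verts G \<Longrightarrow> f G u v = h (dcls G u v)"
proof -
  obtain h where h: "h \<in> borel_measurable borel"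
    "\<forall>G. is_network G \<longrightarrow> (\<forall>u\<in>verts G. \<forall>v\<in>verts G. f G u v = h (dcls G u v))"
    using assms unfolding measurable_kernel_def by blast
  show ?thesis by (rule that[of h]) (use h in auto)
qed

lemma measurable_kernel_cong:
  assumes "measurable_kernel f"
    "\<And>G u v. is_network G \<Longrightarrow> u \<in> verts G \<Longrightarrow> v \<in> verts G \<Longrightarrow> g G u v = f G u v"
  shows "measurable_kernel g"
  using assms unfolding measurable_kernel_def by fastforce

lemma measurable_kernel_fst:
  assumes [measurable]: "w \<in> borel_measurable borel"
  shows "measurable_kernel (\<lambda>G u v. w (rcls G u))"
  by (rule measurable_kernelI[of "\<lambda>y. w (fst_root y)"]) (auto simp: fst_root_dcls)

lemma measurable_kernel_transpose:
  assumes "measurable_kernel f"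
  shows "measurable_kernel (\<lambda>G u v. f G v u)"
proof -
  obtain h where [measurable]: "h \<in> borel_measurable borel"
    and h: "\<And>G u v. is_network G \<Longrightarrow> u \<in> verts G \<Longrightarrow> v \<in> verts G \<Longrightarrow> f G u v = h (dcls G u v)"
    using measurable_kernelE[OF assms] by blast
  show ?thesis by (rule measurable_kernelI[of "\<lambda>y. h (flip y)"]) (auto simp: flip_dcls h)
qed

lemma measurable_kernel_add:
  assumes "measurable_kernel f" "measurable_kernel g"
  shows "measurable_kernel (\<lambda>G u v. f G u v + g G u v)"
  using assms
  by (elim measurable_kernelE, intro measurable_kernelI[OF borel_measurable_add]) auto

lemma measurable_kernel_diff:
  assumes "measurable_kernel f" "measurable_kernel g"
  shows "measurable_kernel (\<lambda>G u v. f G u v - g G u v)"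
  using assms
  by (elim measurable_kernelE, intro measurable_kernelI[OF borel_measurable_diff]) auto

lemma measurable_kernel_lim:
  assumes "\<And>n. measurable_kernel (f n)"
  shows "measurable_kernel (\<lambda>G u v. lim (\<lambda>n. f n G u v))"
proof -
  have "\<exists>h. \<forall>n. h n \<in> borel_measurable borel \<and>
      (\<forall>G. is_network G \<longrightarrow> (\<forall>u\<in>verts G. \<forall>v\<in>verts G. f n G u v = h n (dcls G u v)))"
    using assms unfolding measurable_kernel_def Bex_def by (intro choice allI)
  then obtain h where [measurable]: "\<And>n. h n \<in> borel_measurable borel" and
    h: "\<And>n G u v. is_network G \<Longrightarrow> u \<in> verts G \<Longrightarrow> v \<in> verts G \<Longrightarrow> f n G u v = h n (dcls G u v)"
    by metis
  show ?thesis
    by (rule measurable_kernelI[of "\<lambda>y. lim (\<lambda>n. h n y)"]) (auto simp: h)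
qed

text \<open>
  For a fixed radius this is a sum over the vertices \<open>\<eta>\<close>, hence a Borel function of \<open>[G,u]\<close>. The
  actual radius \<open>d(u,v)\<close> is a Borel function of \<open>[G,u,v]\<close> with countably many values.
\<close>

lemma measurable_kernel_partial_sum:
  assumes f: "measurable_kernel f"
    and nonneg: "\<And>G u v. is_network G \<Longrightarrow> u \<in> verts G \<Longrightarrow> v \<in> verts G \<Longrightarrow> 0 \<le> f G u v"
    and P: "\<And>j k. P j k \<Longrightarrow> j \<le> k"
  shows "measurable_kernel (\<lambda>G u v. \<Sum>\<eta>\<in>{\<eta>\<in>verts G. P (gdist G u \<eta>) (gdist G u v)}. f G u \<eta>)"
proof -
  obtain h where h_meas [measurable]: "h \<in> borel_measurable borel"
    and h: "\<And>G u v. is_network G \<Longrightarrow> u \<in> verts G \<Longrightarrow> v \<in> verts G \<Longrightarrow> f G u v = h (dcls G u v)"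
    using measurable_kernelE[OF f] by blast
  define s where "s k x = enn2real (vertex_sum (\<lambda>y. ennreal (h y) * indicator {y. P (root_dist y) k} y) x)" for k x
  have s_meas: "s k \<in> borel_measurable borel" for k
  proof -
    have "(\<lambda>y. ennreal (h y) * indicator {y. P (root_dist y) k} y) \<in> borel_measurable borel"
      by measurable
    from measurable_vertex_sum[OF this] show ?thesis unfolding s_def by measurable
  qed
  show ?thesis
  proof (rule measurable_kernelI[of "\<lambda>y. s (root_dist y) (fst_root y)"])
    show "(\<lambda>y. s (root_dist y) (fst_root y)) \<in> borel_measurable borel"
      by (rule measurable_compose_countable[where f = "\<lambda>k y. s k (fst_root y)"])
        (use s_meas in measurable)
    fix G :: "'a network" and u v assume G: "is_network G" "u \<in> verts G" "v \<in> verts G"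
    let ?k = "gdist G u v"
    let ?N = "{\<eta>\<in>verts G. P (gdist G u \<eta>) ?k}"
    have fin: "finite ?N"
      by (rule finite_subset[OF _ finite_nbhd[OF G(1,2), of ?k]]) (auto simp: nbhd_def P)
    have "vertex_sum (\<lambda>y. ennreal (h y) * indicator {y. P (root_dist y) ?k} y) (rcls G u) =
        (\<integral>\<^sup>+\<eta>. ennreal (f G u \<eta>) * indicator ?N \<eta> \<partial>count_space (verts G))"
      unfolding vertex_sum_rcls[OF G(1,2)]
      by (rule nn_integral_cong) (use G in \<open>auto simp: indicator_def root_dist_dcls h\<close>)
    also have "\<dots> = (\<Sum>\<eta>\<in>?N. ennreal (f G u \<eta>))"
      by (subst nn_integral_count_space'[OF fin]) (auto intro!: sum.cong)
    also have "\<dots> = ennreal (\<Sum>\<eta>\<in>?N. f G u \<eta>)"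
      using nonneg G by (intro sum_ennreal) auto
    finally show "(\<Sum>\<eta>\<in>?N. f G u \<eta>) = s (root_dist (dcls G u v)) (fst_root (dcls G u v))"
      using nonneg G by (subst enn2real_ennreal[symmetric]) (auto simp: s_def root_dist_dcls fst_root_dcls intro!: sum_nonneg)
  qed
qed

lemma measurable_kernel_greedy:
  assumes w: "w \<in> borel_measurable borel" and f: "measurable_kernel f"
    and nonneg: "\<And>G u v. is_network G \<Longrightarrow> u \<in> verts G \<Longrightarrow> v \<in> verts G \<Longrightarrow> 0 \<le> f G u v"
  shows "measurable_kernel (\<lambda>G u v. greedy (verts G) (gdist G u) (w (rcls G u)) (f G u) v)"
proof -
  note [measurable] = w
  obtain h where [measurable]: "h \<in> borel_measurable borel"
    and h: "\<And>G u v. is_network G \<Longrightarrow> u \<in> verts G \<Longrightarrow> v \<in> verts G \<Longrightarrow> f G u v = h (dcls G u v)"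
    using measurable_kernelE[OF f] by blast
  have "measurable_kernel (\<lambda>G u v. \<Sum>\<eta>\<in>{\<eta>\<in>verts G. gdist G u \<eta> < gdist G u v}. f G u \<eta>)"
    by (rule measurable_kernel_partial_sum[OF f]) (use nonneg in auto)
  then obtain lt where [measurable]: "lt \<in> borel_measurable borel"
    and lt: "\<And>G u v. is_network G \<Longrightarrow> u \<in> verts G \<Longrightarrow> v \<in> verts G \<Longrightarrow>
      (\<Sum>\<eta>\<in>{\<eta>\<in>verts G. gdist G u \<eta> < gdist G u v}. f G u \<eta>) = lt (dcls G u v)"
    using measurable_kernelE by blast
  have "measurable_kernel (\<lambda>G u v. \<Sum>\<eta>\<in>{\<eta>\<in>verts G. gdist G u \<eta> = gdist G u v}. f G u \<eta>)"
    by (rule measurable_kernel_partial_sum[OF f]) (use nonneg in auto)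
  then obtain eq where [measurable]: "eq \<in> borel_measurable borel"
    and eq: "\<And>G u v. is_network G \<Longrightarrow> u \<in> verts G \<Longrightarrow> v \<in> verts G \<Longrightarrow>
      (\<Sum>\<eta>\<in>{\<eta>\<in>verts G. gdist G u \<eta> = gdist G u v}. f G u \<eta>) = eq (dcls G u v)"
    using measurable_kernelE by blast
  show ?thesis
  proof (rule measurable_kernelI[of "\<lambda>y. h y * max 0 (min 1 ((w (fst_root y) - lt y) / eq y))"])
    show "(\<lambda>y. h y * max 0 (min 1 ((w (fst_root y) - lt y) / eq y))) \<in> borel_measurable borel"
      by measurable
    fix G :: "'a network" and u v assume G: "is_network G" "u \<in> verts G" "v \<in> verts G"
    then show "greedy (verts G) (gdist G u) (w (rcls G u)) (f G u) v =
      h (dcls G u v) * max 0 (min 1 ((w (fst_root (dcls G u v)) - lt (dcls G u v)) / eq (dcls G u v)))"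
      unfolding greedy_def by (simp only: lt eq h fst_root_dcls)
  qed
qed

section \<open>Stable transport in a single network\<close>
lemma infsum_eq_SUP_nbhd:
  fixes f :: "nat \<Rightarrow> ennreal"
  assumes "is_network G" "u \<in> verts G"
  shows "infsum f (verts G) = (SUP k. \<Sum>v\<in>nbhd G k u. f v)"
proof -
  have "(SUP F\<in>{F. finite F \<and> F \<subseteq> verts G}. sum f F) \<le> (SUP k. \<Sum>v\<in>nbhd G k u. f v)"
  proof (rule SUP_least)
    fix F assume F: "F \<in> {F. finite F \<and> F \<subseteq> verts G}"
    define k where "k = Max (insert 0 (gdist G u ` F))"
    have "F \<subseteq> nbhd G k u" using F by (auto simp: nbhd_def k_def)
    then have "sum f F \<le> (\<Sum>v\<in>nbhd G k u. f v)" using finite_nbhd[OF assms] by (intro sum_mono2) auto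
    then show "sum f F \<le> (SUP k. \<Sum>v\<in>nbhd G k u. f v)" by (rule SUP_upper2[OF UNIV_I])
  qed
  moreover have "(SUP k. \<Sum>v\<in>nbhd G k u. f v) \<le> (SUP F\<in>{F. finite F \<and> F \<subseteq> verts G}. sum f F)"
  proof (rule SUP_least)
    fix k
    have "nbhd G k u \<in> {F. finite F \<and> F \<subseteq> verts G}" using finite_nbhd[OF assms] nbhd_verts by blast
    then show "(\<Sum>v\<in>nbhd G k u. f v) \<le> (SUP F\<in>{F. finite F \<and> F \<subseteq> verts G}. sum f F)"
      by (rule SUP_upper)
  qed
  ultimately show ?thesis by (subst nonneg_infsum_complete) (auto intro: order_antisym)
qed

locale network_demands =
  fixes G :: "'m network" and w1 w2 :: "'m rnet \<Rightarrow> real"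
  assumes net: "is_network G" and w1: "\<And>z. 0 \<le> w1 z" and w2: "\<And>z. 0 \<le> w2 z"
begin

lemma graded_network: "x \<in> verts G \<Longrightarrow> graded_supply (verts G) (gdist G x)"
  using finite_nbhd[OF net] by unfold_locales (simp add: nbhd_def)

definition unrejected :: "(nat \<Rightarrow> nat \<Rightarrow> real) \<Rightarrow> nat \<Rightarrow> nat \<Rightarrow> real" where
  "unrejected R x \<xi> = w2 (rcls G \<xi>) - R x \<xi>"

text \<open>
  The last clause says that a site rejects \<open>x\<close> only if the supply that is left to \<open>x\<close> strictly closer
  than that site does not meet the demand of \<open>x\<close>. It is what makes the rule \<open>A = 0\<close> beyond the
  application radius agree with the greedy share, which leaves \<open>A = R\<close> there.
\<close>

definition admissible :: "(nat \<Rightarrow> nat \<Rightarrow> real) \<Rightarrow> bool" where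
  "admissible R \<longleftrightarrow> (\<forall>x\<in>verts G. \<forall>\<xi>\<in>verts G. 0 \<le> R x \<xi> \<and> R x \<xi> \<le> w2 (rcls G \<xi>) \<and>
     (w1 (rcls G x) \<le> (\<Sum>\<eta>\<in>{\<eta>\<in>verts G. gdist G x \<eta> < gdist G x \<xi>}. unrejected R x \<eta>) \<longrightarrow> R x \<xi> = 0))"

text \<open>
  After subtraction of \<open>R\<close>, the three cases of the application rule take all, the fraction \<open>1 - c\<close>, or
  nothing of the unrejected supply, which is the situation of \<open>greedy_unique\<close>.
\<close>

lemma applied_eq_greedy:
  assumes R: "admissible R" and x: "x \<in> verts G" and \<xi>: "\<xi> \<in> verts G"
  shows "applied G w1 w2 R x \<xi> =
    R x \<xi> + greedy (verts G) (gdist G x) (w1 (rcls G x)) (unrejected R x) \<xi>"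
proof -
  interpret graded_supply "verts G" "gdist G x" by (rule graded_network[OF x])
  define \<rho> where "\<rho> = Inf {enat a |a. w1 (rcls G x) \<le> (\<Sum>\<eta>\<in>{\<eta>\<in>verts G. gdist G x \<eta> \<le> a}. unrejected R x \<eta>)}"
  define taken where "taken c \<eta> = (if enat (gdist G x \<eta>) < \<rho> then unrejected R x \<eta>
    else if enat (gdist G x \<eta>) = \<rho> then (1 - c) * unrejected R x \<eta> else 0)" for c \<eta>
  have \<rho>: "apply_radius G w1 w2 R x = \<rho>"
    by (simp add: apply_radius_def \<rho>_def nbhd_def unrejected_def)
  have nonneg: "\<And>\<eta>. \<eta> \<in> verts G \<Longrightarrow> 0 \<le> unrejected R x \<eta>"
    using R x by (auto simp: admissible_def unrejected_def)
  have eq: "applied_with G w1 w2 R c x \<eta> - R x \<eta> = taken c \<eta>" if \<eta>: "\<eta> \<in> verts G" for c \<eta>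
  proof -
    have "R x \<eta> = 0" if "enat (gdist G x \<eta>) > \<rho>"
      using greedy_unique(2)[where f = "unrejected R x" and w = "w1 (rcls G x)", OF nonneg w1 \<eta>] that R x \<eta> unfolding \<rho>_def admissible_def by blast
    moreover have "enat (gdist G x \<eta>) < \<rho> \<or> enat (gdist G x \<eta>) = \<rho> \<or> enat (gdist G x \<eta>) > \<rho>"
      by (rule less_linear)
    ultimately show ?thesis
      by (auto simp: applied_with_def \<rho> taken_def unrejected_def algebra_simps)
  qed
  then have "(\<Sum>\<^sub>\<infinity>\<eta>\<in>verts G. applied_with G w1 w2 R c x \<eta> - R x \<eta>) = (\<Sum>\<^sub>\<infinity>\<eta>\<in>verts G. taken c \<eta>)" for c
    by (intro infsum_cong) auto
  then have "applied G w1 w2 R x \<xi> - R x \<xi> =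
      taken (SOME c. c \<in> {0..1} \<and> (\<Sum>\<^sub>\<infinity>\<eta>\<in>verts G. taken c \<eta>) = w1 (rcls G x)) \<xi>"
    using eq[OF \<xi>] by (simp add: applied_def)
  also have "\<dots> = greedy (verts G) (gdist G x) (w1 (rcls G x)) (unrejected R x) \<xi>"
    using greedy_unique(1)[where f = "unrejected R x" and w = "w1 (rcls G x)", OF nonneg w1 \<xi>] unfolding taken_def \<rho>_def .
  finally show ?thesis by simp
qed

lemma rejected_eq_greedy:
  assumes nonneg: "\<And>x. x \<in> verts G \<Longrightarrow> 0 \<le> A x \<xi>" and x: "x \<in> verts G" and \<xi>: "\<xi> \<in> verts G"
  shows "rejected G w2 A x \<xi> =
    A x \<xi> - greedy (verts G) (gdist G \<xi>) (w2 (rcls G \<xi>)) (\<lambda>y. A y \<xi>) x"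
proof -
  interpret graded_supply "verts G" "gdist G \<xi>" by (rule graded_network[OF \<xi>])
  define \<rho> where "\<rho> = Inf {enat a |a. w2 (rcls G \<xi>) \<le> (\<Sum>y\<in>{y\<in>verts G. gdist G \<xi> y \<le> a}. A y \<xi>)}"
  define taken where "taken c y = (if enat (gdist G \<xi> y) < \<rho> then A y \<xi>
    else if enat (gdist G \<xi> y) = \<rho> then (1 - c) * A y \<xi> else 0)" for c y
  have \<rho>: "reject_radius G w2 A \<xi> = \<rho>"
    by (simp add: reject_radius_def \<rho>_def nbhd_def)
  have eq: "A y \<xi> - rejected_with G w2 A c y \<xi> = taken c y" for c y
    by (simp add: rejected_with_def \<rho> taken_def gdist_sym[of G y \<xi>] algebra_simps)
  have "A x \<xi> - rejected G w2 A x \<xi> =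
      taken (SOME c. c \<in> {0..1} \<and> (\<Sum>\<^sub>\<infinity>y\<in>verts G. taken c y) = w2 (rcls G \<xi>)) x"
    by (simp add: rejected_def eq)
  also have "\<dots> = greedy (verts G) (gdist G \<xi>) (w2 (rcls G \<xi>)) (\<lambda>y. A y \<xi>) x"
    using greedy_unique(1)[where f = "\<lambda>y. A y \<xi>" and w = "w2 (rcls G \<xi>)", OF nonneg w2 x] unfolding taken_def \<rho>_def by simp
  finally show ?thesis by simp
qed

text \<open>
  Since stages are numbered from 1, \<open>App n\<close> is the application of stage \<open>n + 1\<close>, whose answer is
  \<open>Rej (Suc n)\<close>.
\<close>

abbreviation (input) "Rej \<equiv> rejection G w1 w2"
abbreviation (input) "App n \<equiv> applied G w1 w2 (rejection G w1 w2 n)"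

lemma applied_bounds:
  assumes R: "admissible R" and x: "x \<in> verts G" and \<xi>: "\<xi> \<in> verts G"
  shows "R x \<xi> \<le> applied G w1 w2 R x \<xi>" "applied G w1 w2 R x \<xi> \<le> w2 (rcls G \<xi>)"
proof -
  interpret graded_supply "verts G" "gdist G x" by (rule graded_network[OF x])
  have "0 \<le> unrejected R x \<xi>" using R x \<xi> by (auto simp: admissible_def unrejected_def)
  from greedy_bounds[where f = "unrejected R x" and w = "w1 (rcls G x)", OF this]
  show "R x \<xi> \<le> applied G w1 w2 R x \<xi>" "applied G w1 w2 R x \<xi> \<le> w2 (rcls G \<xi>)"
    by (auto simp: applied_eq_greedy[OF assms] unrejected_def)
qed

lemma rejected_bounds:
  assumes A: "\<And>x. x \<in> verts G \<Longrightarrow> 0 \<le> A x \<xi>" and x: "x \<in> verts G" and \<xi>: "\<xi> \<in> verts G"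
  shows "0 \<le> rejected G w2 A x \<xi>" "rejected G w2 A x \<xi> \<le> A x \<xi>"
proof -
  interpret graded_supply "verts G" "gdist G \<xi>" by (rule graded_network[OF \<xi>])
  from greedy_bounds[of "\<lambda>y. A y \<xi>" x "w2 (rcls G \<xi>)", OF A[OF x]]
  show "0 \<le> rejected G w2 A x \<xi>" "rejected G w2 A x \<xi> \<le> A x \<xi>"
    by (auto simp: rejected_eq_greedy[where A = A, OF assms])
qed

text \<open>
  More rejections mean a smaller supply, hence a smaller surplus, and the surplus of \<open>x\<close> is \<open>w\<^sub>2 - A\<close>.
\<close>

lemma applied_mono:
  assumes "admissible R" "admissible R'" "\<And>\<xi>. \<xi> \<in> verts G \<Longrightarrow> R x \<xi> \<le> R' x \<xi>"
    and x: "x \<in> verts G" and \<xi>: "\<xi> \<in> verts G"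
  shows "applied G w1 w2 R x \<xi> \<le> applied G w1 w2 R' x \<xi>"
proof -
  interpret graded_supply "verts G" "gdist G x" by (rule graded_network[OF x])
  have "unrejected R' x \<xi> - greedy (verts G) (gdist G x) (w1 (rcls G x)) (unrejected R' x) \<xi>
      \<le> unrejected R x \<xi> - greedy (verts G) (gdist G x) (w1 (rcls G x)) (unrejected R x) \<xi>"
    by (rule greedy_surplus_mono) (use assms in \<open>auto simp: unrejected_def admissible_def\<close>)
  then show ?thesis
    using assms(1,2) x \<xi> by (simp add: applied_eq_greedy unrejected_def)
qed

text \<open>
  The rejected part is the surplus of the site, with the applications as supply.
\<close>

lemma rejected_mono:
  assumes A: "\<And>x. x \<in> verts G \<Longrightarrow> 0 \<le> A x \<xi>" and le: "\<And>x. x \<in> verts G \<Longrightarrow> A x \<xi> \<le> A' x \<xi>"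
    and x: "x \<in> verts G" and \<xi>: "\<xi> \<in> verts G"
  shows "rejected G w2 A x \<xi> \<le> rejected G w2 A' x \<xi>"
proof -
  interpret graded_supply "verts G" "gdist G \<xi>" by (rule graded_network[OF \<xi>])
  have A': "\<And>x. x \<in> verts G \<Longrightarrow> 0 \<le> A' x \<xi>" using A le by (meson order_trans)
  show ?thesis
    using greedy_surplus_mono[where f = "\<lambda>y. A y \<xi>" and g = "\<lambda>y. A' y \<xi>" and w = "w2 (rcls G \<xi>)", OF A le x]
    by (simp add: rejected_eq_greedy[where A = A, OF A x \<xi>] rejected_eq_greedy[where A = A', OF A' x \<xi>])
qed

text \<open>
  The two claims need each other. If at the next stage the demand of \<open>x\<close> is met strictly closer than
  \<open>\<xi>\<close>, then, the unrejected supply having decreased, it was so at this stage already; thus \<open>x\<close> did not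
  apply to \<open>\<xi>\<close> and was not rejected there, which is the last clause of admissibility. Conversely, the
  comparison of the applications of two stages needs admissibility for both.
\<close>

lemma rejection_invariant:
  "admissible (Rej n) \<and> (\<forall>x\<in>verts G. \<forall>\<xi>\<in>verts G. Rej n x \<xi> \<le> Rej (Suc n) x \<xi>)"
proof (induction n)
  case 0
  have adm: "admissible (Rej 0)" using w2 by (auto simp: admissible_def)
  moreover have "Rej 0 x \<xi> \<le> Rej (Suc 0) x \<xi>" if "x \<in> verts G" "\<xi> \<in> verts G" for x \<xi>
    using rejected_bounds(1)[of "App 0" \<xi> x] applied_bounds(1)[OF adm] that by simp
  ultimately show ?case by blast
next
  case (Suc n)
  then have adm: "admissible (Rej n)"
    and mono: "\<And>x \<xi>. x \<in> verts G \<Longrightarrow> \<xi> \<in> verts G \<Longrightarrow> Rej n x \<xi> \<le> Rej (Suc n) x \<xi>" by auto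
  have App_nonneg: "0 \<le> App n x \<xi>" if "x \<in> verts G" "\<xi> \<in> verts G" for x \<xi>
  proof -
    have "0 \<le> Rej n x \<xi>" using adm that by (simp add: admissible_def)
    also have "\<dots> \<le> App n x \<xi>" by (rule applied_bounds(1)[OF adm that])
    finally show ?thesis .
  qed
  have adm': "admissible (Rej (Suc n))"
    unfolding admissible_def
  proof (intro ballI conjI impI)
    fix x \<xi> assume x: "x \<in> verts G" and \<xi>: "\<xi> \<in> verts G"
    interpret graded_supply "verts G" "gdist G x" by (rule graded_network[OF x])
    have b: "0 \<le> Rej (Suc n) x \<xi>" "Rej (Suc n) x \<xi> \<le> App n x \<xi>"
      using rejected_bounds[of "App n" \<xi> x] App_nonneg x \<xi> by auto
    show "0 \<le> Rej (Suc n) x \<xi>" by (rule b)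
    show "Rej (Suc n) x \<xi> \<le> w2 (rcls G \<xi>)" using b(2) applied_bounds(2)[OF adm x \<xi>] by linarith
    assume "w1 (rcls G x) \<le> (\<Sum>\<eta>\<in>{\<eta>\<in>verts G. gdist G x \<eta> < gdist G x \<xi>}. unrejected (Rej (Suc n)) x \<eta>)"
    also have "\<dots> \<le> (\<Sum>\<eta>\<in>{\<eta>\<in>verts G. gdist G x \<eta> < gdist G x \<xi>}. unrejected (Rej n) x \<eta>)"
      using mono[OF x] by (intro sum_mono) (auto simp: unrejected_def simp del: rejection.simps)
    finally have le: "w1 (rcls G x) \<le> (\<Sum>\<eta>\<in>{\<eta>\<in>verts G. gdist G x \<eta> < gdist G x \<xi>}. unrejected (Rej n) x \<eta>)" .
    then have "Rej n x \<xi> = 0" using adm x \<xi> by (auto simp: admissible_def)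
    moreover have "greedy (verts G) (gdist G x) (w1 (rcls G x)) (unrejected (Rej n) x) \<xi> = 0"
      by (rule greedy_takes_none[OF _ le]) (use adm x in \<open>auto simp: admissible_def unrejected_def\<close>)
    ultimately have "App n x \<xi> = 0" by (simp add: applied_eq_greedy[OF adm x \<xi>])
    then show "Rej (Suc n) x \<xi> = 0" using b by linarith
  qed
  have "Rej (Suc n) x \<xi> \<le> Rej (Suc (Suc n)) x \<xi>" if x: "x \<in> verts G" and \<xi>: "\<xi> \<in> verts G" for x \<xi>
  proof -
    have "rejected G w2 (App n) x \<xi> \<le> rejected G w2 (App (Suc n)) x \<xi>"
      by (rule rejected_mono) (rule App_nonneg applied_mono[OF adm adm' mono] x \<xi> | assumption)+
    then show ?thesis by (simp only: rejection.simps(2))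
  qed
  with adm' show ?case by blast
qed

lemmas admissible_rejection = rejection_invariant[THEN conjunct1]
  and rejection_Suc_le = rejection_invariant[THEN conjunct2, rule_format]

lemma applied_nonneg:
  assumes "x \<in> verts G" "\<xi> \<in> verts G"
  shows "0 \<le> App n x \<xi>"
proof -
  have "0 \<le> Rej n x \<xi>" using admissible_rejection[of n] assms by (simp add: admissible_def)
  also have "\<dots> \<le> App n x \<xi>" by (rule applied_bounds(1)[OF admissible_rejection assms])
  finally show ?thesis .
qed

lemma transport_limits:
  "\<exists>A R. \<forall>x\<in>verts G. \<forall>\<xi>\<in>verts G. (\<lambda>n. App n x \<xi>) \<longlonglongrightarrow> A x \<xi> \<and>
     (\<lambda>n. Rej n x \<xi>) \<longlonglongrightarrow> R x \<xi> \<and> stable_transport G w1 w2 x \<xi> = A x \<xi> - R x \<xi>"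
proof -
  define A where "A x \<xi> = lim (\<lambda>n. App n x \<xi>)" for x \<xi>
  define R where "R x \<xi> = lim (\<lambda>n. Rej n x \<xi>)" for x \<xi>
  note adm = admissible_rejection
  have bounds: "\<bar>App n x \<xi>\<bar> \<le> w2 (rcls G \<xi>)" "\<bar>Rej n x \<xi>\<bar> \<le> w2 (rcls G \<xi>)"
    if "x \<in> verts G" "\<xi> \<in> verts G" for n x \<xi>
    using applied_nonneg[OF that, of n] applied_bounds[OF adm that, of n] adm[of n] that
    by (auto simp: admissible_def)
  have A: "(\<lambda>n. App n x \<xi>) \<longlonglongrightarrow> A x \<xi>" if "x \<in> verts G" "\<xi> \<in> verts G" for x \<xi>
  proof -
    have "incseq (\<lambda>n. App n x \<xi>)"
      by (rule incseq_SucI, rule applied_mono[OF adm adm]) (use rejection_Suc_le that in blast)+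
    then show ?thesis unfolding A_def
      using bounds(1)[OF that] by (intro convergent_LIMSEQ_iff[THEN iffD1] Bseq_monoseq_convergent)
        (auto intro!: BseqI'[of _ "w2 (rcls G \<xi>)"] simp: incseq_imp_monoseq)
  qed
  have R: "(\<lambda>n. Rej n x \<xi>) \<longlonglongrightarrow> R x \<xi>" if "x \<in> verts G" "\<xi> \<in> verts G" for x \<xi>
  proof -
    have "incseq (\<lambda>n. Rej n x \<xi>)"
      by (rule incseq_SucI) (rule rejection_Suc_le[OF that])
    then show ?thesis unfolding R_def
      using bounds(2)[OF that] by (intro convergent_LIMSEQ_iff[THEN iffD1] Bseq_monoseq_convergent)
        (auto intro!: BseqI'[of _ "w2 (rcls G \<xi>)"] simp: incseq_imp_monoseq)
  qed
  have "stable_transport G w1 w2 x \<xi> = A x \<xi> - R x \<xi>" if "x \<in> verts G" "\<xi> \<in> verts G" for x \<xi>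
  proof -
    have "(\<lambda>n. application G w1 w2 n x \<xi>) \<longlonglongrightarrow> A x \<xi>"
      by (rule LIMSEQ_imp_Suc) (use A[OF that] in \<open>simp add: application_def\<close>)
    then show ?thesis using R[OF that] by (simp add: stable_transport_def limI)
  qed
  with A R show ?thesis by blast
qed

lemma sum_applied_minus_rejection:
  assumes x: "x \<in> verts G"
  shows "(\<Sum>\<xi>\<in>nbhd G k x. App n x \<xi> - Rej n x \<xi>) =
    min (w1 (rcls G x)) (\<Sum>\<xi>\<in>nbhd G k x. w2 (rcls G \<xi>) - Rej n x \<xi>)"
proof -
  interpret graded_supply "verts G" "gdist G x" by (rule graded_network[OF x])
  have "(\<Sum>\<xi>\<in>nbhd G k x. App n x \<xi> - Rej n x \<xi>) = (\<Sum>\<xi>\<in>nbhd G k x.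
      greedy (verts G) (gdist G x) (w1 (rcls G x)) (unrejected (Rej n) x) \<xi>)"
  proof (rule sum.cong[OF refl])
    fix \<xi> assume "\<xi> \<in> nbhd G k x"
    then have "\<xi> \<in> verts G" by (simp add: nbhd_def)
    then show "App n x \<xi> - Rej n x \<xi> =
        greedy (verts G) (gdist G x) (w1 (rcls G x)) (unrejected (Rej n) x) \<xi>"
      using applied_eq_greedy[OF admissible_rejection x, of \<xi> n] by linarith
  qed
  also have "\<dots> = min (w1 (rcls G x)) (\<Sum>\<xi>\<in>nbhd G k x. unrejected (Rej n) x \<xi>)"
    unfolding nbhd_def
    by (rule sum_greedy_level[OF _ w1]) (use admissible_rejection[of n] x in \<open>auto simp: admissible_def unrejected_def\<close>)
  finally show ?thesis by (simp only: unrejected_def)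
qed

lemma sum_applied_minus_rejected:
  assumes \<xi>: "\<xi> \<in> verts G"
  shows "(\<Sum>x\<in>nbhd G k \<xi>. App n x \<xi> - Rej (Suc n) x \<xi>) =
    min (w2 (rcls G \<xi>)) (\<Sum>x\<in>nbhd G k \<xi>. App n x \<xi>)"
proof -
  interpret graded_supply "verts G" "gdist G \<xi>" by (rule graded_network[OF \<xi>])
  have "(\<Sum>x\<in>nbhd G k \<xi>. App n x \<xi> - Rej (Suc n) x \<xi>) = (\<Sum>x\<in>nbhd G k \<xi>.
      greedy (verts G) (gdist G \<xi>) (w2 (rcls G \<xi>)) (\<lambda>y. App n y \<xi>) x)"
  proof (rule sum.cong[OF refl])
    fix x assume "x \<in> nbhd G k \<xi>"
    then have "x \<in> verts G" by (simp add: nbhd_def)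
    then show "App n x \<xi> - Rej (Suc n) x \<xi> =
        greedy (verts G) (gdist G \<xi>) (w2 (rcls G \<xi>)) (\<lambda>y. App n y \<xi>) x"
      using rejected_eq_greedy[where A = "App n", OF applied_nonneg[OF _ \<xi>] _ \<xi>, of x] by simp
  qed
  also have "\<dots> = min (w2 (rcls G \<xi>)) (\<Sum>x\<in>nbhd G k \<xi>. App n x \<xi>)"
    unfolding nbhd_def by (rule sum_greedy_level[OF _ w2]) (rule applied_nonneg[OF _ \<xi>])
  finally show ?thesis .
qed

text \<open>
  The ball identities of the single stages survive the limit because balls are finite. Suppose that
  \<open>\<xi>\<close> is not saturated. Then no vertex \<open>x\<close> can have applied fully to \<open>\<xi>\<close>: otherwise the applications
  to \<open>\<xi>\<close> from a ball containing \<open>x\<close> would reach \<open>w\<^sub>2(\<xi>)\<close>, and the ball identity at \<open>\<xi>\<close> would yield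
  saturation. So \<open>T(x,\<xi>)\<close> is smaller than the unrejected supply at \<open>\<xi>\<close>, the minimum in the ball
  identity at \<open>x\<close> is the demand, and \<open>x\<close> is exhausted.
\<close>

lemma stable_transport_balance:
  defines "T \<equiv> stable_transport G w1 w2"
  shows "\<And>x \<xi>. x \<in> verts G \<Longrightarrow> \<xi> \<in> verts G \<Longrightarrow> 0 \<le> T x \<xi>"
    and "\<And>x. x \<in> verts G \<Longrightarrow> (\<Sum>\<^sub>\<infinity>\<xi>\<in>verts G. ennreal (T x \<xi>)) \<le> ennreal (w1 (rcls G x))"
    and "\<And>\<xi>. \<xi> \<in> verts G \<Longrightarrow> (\<Sum>\<^sub>\<infinity>x\<in>verts G. ennreal (T x \<xi>)) \<le> ennreal (w2 (rcls G \<xi>))"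
    and "(\<forall>x\<in>verts G. (\<Sum>\<^sub>\<infinity>\<xi>\<in>verts G. ennreal (T x \<xi>)) = ennreal (w1 (rcls G x))) \<or>
      (\<forall>\<xi>\<in>verts G. (\<Sum>\<^sub>\<infinity>x\<in>verts G. ennreal (T x \<xi>)) = ennreal (w2 (rcls G \<xi>)))"
proof -
  let ?V = "verts G"
  obtain A R where lim: "\<forall>x\<in>?V. \<forall>\<xi>\<in>?V. (\<lambda>n. App n x \<xi>) \<longlonglongrightarrow> A x \<xi> \<and>
      (\<lambda>n. Rej n x \<xi>) \<longlonglongrightarrow> R x \<xi> \<and> stable_transport G w1 w2 x \<xi> = A x \<xi> - R x \<xi>"
    using transport_limits by blast
  then have A: "(\<lambda>n. App n x \<xi>) \<longlonglongrightarrow> A x \<xi>" and R: "(\<lambda>n. Rej n x \<xi>) \<longlonglongrightarrow> R x \<xi>"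
    and T: "T x \<xi> = A x \<xi> - R x \<xi>" if "x \<in> ?V" "\<xi> \<in> ?V" for x \<xi>
    using that unfolding T_def by blast+
  note adm = admissible_rejection
  have V: "z \<in> ?V" if "z \<in> nbhd G k x" for z k x using that by (simp add: nbhd_def)
  have out_ball: "(\<Sum>\<xi>\<in>nbhd G k x. T x \<xi>) = min (w1 (rcls G x)) (\<Sum>\<xi>\<in>nbhd G k x. w2 (rcls G \<xi>) - R x \<xi>)"
    if x: "x \<in> ?V" for x k
  proof (rule LIMSEQ_unique)
    show "(\<lambda>n. \<Sum>\<xi>\<in>nbhd G k x. App n x \<xi> - Rej n x \<xi>) \<longlonglongrightarrow> (\<Sum>\<xi>\<in>nbhd G k x. T x \<xi>)"
      by (intro tendsto_sum) (use A R T x V in \<open>auto intro!: tendsto_diff\<close>)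
    show "(\<lambda>n. \<Sum>\<xi>\<in>nbhd G k x. App n x \<xi> - Rej n x \<xi>) \<longlonglongrightarrow>
        min (w1 (rcls G x)) (\<Sum>\<xi>\<in>nbhd G k x. w2 (rcls G \<xi>) - R x \<xi>)"
      unfolding sum_applied_minus_rejection[OF x]
      by (intro tendsto_min tendsto_sum tendsto_diff tendsto_const R x V)
  qed
  have in_ball: "(\<Sum>x\<in>nbhd G k \<xi>. T x \<xi>) = min (w2 (rcls G \<xi>)) (\<Sum>x\<in>nbhd G k \<xi>. A x \<xi>)"
    if \<xi>: "\<xi> \<in> ?V" for \<xi> k
  proof (rule LIMSEQ_unique)
    show "(\<lambda>n. \<Sum>x\<in>nbhd G k \<xi>. App n x \<xi> - Rej (Suc n) x \<xi>) \<longlonglongrightarrow> (\<Sum>x\<in>nbhd G k \<xi>. T x \<xi>)"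
    proof (rule tendsto_sum)
      fix x assume "x \<in> nbhd G k \<xi>"
      then have x: "x \<in> ?V" by (rule V)
      show "(\<lambda>n. App n x \<xi> - Rej (Suc n) x \<xi>) \<longlonglongrightarrow> T x \<xi>"
        unfolding T[OF x \<xi>] by (intro tendsto_diff A LIMSEQ_Suc[OF R] x \<xi>)
    qed
    show "(\<lambda>n. \<Sum>x\<in>nbhd G k \<xi>. App n x \<xi> - Rej (Suc n) x \<xi>) \<longlonglongrightarrow>
        min (w2 (rcls G \<xi>)) (\<Sum>x\<in>nbhd G k \<xi>. A x \<xi>)"
      unfolding sum_applied_minus_rejected[OF \<xi>]
      by (intro tendsto_min tendsto_sum tendsto_const A \<xi> V)
  qed
  have A_le: "A x \<xi> \<le> w2 (rcls G \<xi>)" if "x \<in> ?V" "\<xi> \<in> ?V" for x \<xi>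
    by (rule LIMSEQ_le_const2[OF A[OF that]]) (use applied_bounds(2)[OF adm that] in blast)
  have A_nonneg: "0 \<le> A x \<xi>" if "x \<in> ?V" "\<xi> \<in> ?V" for x \<xi>
    by (rule LIMSEQ_le_const[OF A[OF that]]) (use applied_nonneg[OF that] in blast)
  show T_nonneg: "0 \<le> T x \<xi>" if "x \<in> ?V" "\<xi> \<in> ?V" for x \<xi>
  proof -
    have "R x \<xi> \<le> A x \<xi>"
      by (rule LIMSEQ_le[OF R[OF that] A[OF that]]) (use applied_bounds(1)[OF adm that] in blast)
    then show ?thesis using T[OF that] by simp
  qed
  have sum_out: "(\<Sum>\<xi>\<in>nbhd G k x. ennreal (T x \<xi>)) = ennreal (\<Sum>\<xi>\<in>nbhd G k x. T x \<xi>)" if "x \<in> ?V" for x k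
    using T_nonneg that V by (intro sum_ennreal) auto
  have sum_in: "(\<Sum>x\<in>nbhd G k \<xi>. ennreal (T x \<xi>)) = ennreal (\<Sum>x\<in>nbhd G k \<xi>. T x \<xi>)" if "\<xi> \<in> ?V" for \<xi> k
    using T_nonneg that V by (intro sum_ennreal) auto
  show out_le: "(\<Sum>\<^sub>\<infinity>\<xi>\<in>?V. ennreal (T x \<xi>)) \<le> ennreal (w1 (rcls G x))" if x: "x \<in> ?V" for x
    unfolding infsum_eq_SUP_nbhd[OF net x] by (rule SUP_least) (simp add: sum_out[OF x] out_ball[OF x] ennreal_leI)
  show in_le: "(\<Sum>\<^sub>\<infinity>x\<in>?V. ennreal (T x \<xi>)) \<le> ennreal (w2 (rcls G \<xi>))" if \<xi>: "\<xi> \<in> ?V" for \<xi>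
    unfolding infsum_eq_SUP_nbhd[OF net \<xi>] by (rule SUP_least) (simp add: sum_in[OF \<xi>] in_ball[OF \<xi>] ennreal_leI)
  show "(\<forall>x\<in>?V. (\<Sum>\<^sub>\<infinity>\<xi>\<in>?V. ennreal (T x \<xi>)) = ennreal (w1 (rcls G x))) \<or>
      (\<forall>\<xi>\<in>?V. (\<Sum>\<^sub>\<infinity>x\<in>?V. ennreal (T x \<xi>)) = ennreal (w2 (rcls G \<xi>)))"
  proof (intro disjCI ballI)
    fix x assume x: "x \<in> ?V" and unsat: "\<not> (\<forall>\<xi>\<in>?V. (\<Sum>\<^sub>\<infinity>x\<in>?V. ennreal (T x \<xi>)) = ennreal (w2 (rcls G \<xi>)))"
    then obtain \<xi> where \<xi>: "\<xi> \<in> ?V" "(\<Sum>\<^sub>\<infinity>x\<in>?V. ennreal (T x \<xi>)) \<noteq> ennreal (w2 (rcls G \<xi>))" by blast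
    let ?k = "gdist G x \<xi>"
    have "A x \<xi> < w2 (rcls G \<xi>)"
    proof (rule ccontr)
      assume "\<not> A x \<xi> < w2 (rcls G \<xi>)"
      moreover have "A x \<xi> \<le> (\<Sum>y\<in>nbhd G ?k \<xi>. A y \<xi>)"
      proof (rule member_le_sum)
        show "x \<in> nbhd G ?k \<xi>" using x by (simp add: nbhd_def gdist_sym[of G \<xi> x])
        show "0 \<le> A y \<xi>" if "y \<in> nbhd G ?k \<xi> - {x}" for y using that A_nonneg[OF V \<xi>(1)] by blast
      qed (rule finite_nbhd[OF net \<xi>(1)])
      ultimately have "(\<Sum>y\<in>nbhd G ?k \<xi>. T y \<xi>) = w2 (rcls G \<xi>)" using in_ball[OF \<xi>(1), of ?k] by simp
      then have "ennreal (w2 (rcls G \<xi>)) \<le> (\<Sum>\<^sub>\<infinity>x\<in>?V. ennreal (T x \<xi>))"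
        unfolding infsum_eq_SUP_nbhd[OF net \<xi>(1)] by (intro SUP_upper2[of ?k]) (simp_all add: sum_in[OF \<xi>(1)])
      with in_le[OF \<xi>(1)] \<xi>(2) show False by simp
    qed
    then have less: "T x \<xi> < w2 (rcls G \<xi>) - R x \<xi>" using T[OF x \<xi>(1)] by simp
    have le: "T x \<eta> \<le> w2 (rcls G \<eta>) - R x \<eta>" if "\<eta> \<in> ?V" for \<eta>
      using T[OF x that] A_le[OF x that] by simp
    have "(\<Sum>\<eta>\<in>nbhd G ?k x. T x \<eta>) < (\<Sum>\<eta>\<in>nbhd G ?k x. w2 (rcls G \<eta>) - R x \<eta>)"
    proof (intro sum_strict_mono_ex1 ballI)
      show "\<exists>\<eta>\<in>nbhd G ?k x. T x \<eta> < w2 (rcls G \<eta>) - R x \<eta>"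
        by (rule bexI[of _ \<xi>]) (use \<xi>(1) less in \<open>auto simp: nbhd_def\<close>)
      show "T x \<eta> \<le> w2 (rcls G \<eta>) - R x \<eta>" if "\<eta> \<in> nbhd G ?k x" for \<eta>
        by (rule le[OF V[OF that]])
    qed (rule finite_nbhd[OF net x])
    then have "(\<Sum>\<eta>\<in>nbhd G ?k x. T x \<eta>) = w1 (rcls G x)" using out_ball[OF x, of ?k] by simp
    then have "ennreal (w1 (rcls G x)) \<le> (\<Sum>\<^sub>\<infinity>\<xi>\<in>?V. ennreal (T x \<xi>))"
      unfolding infsum_eq_SUP_nbhd[OF net x] by (intro SUP_upper2[of ?k]) (simp_all add: sum_out[OF x])
    with out_le[OF x] show "(\<Sum>\<^sub>\<infinity>\<xi>\<in>?V. ennreal (T x \<xi>)) = ennreal (w1 (rcls G x))" by simp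
  qed
qed

end

section \<open>Measurability of the stable transport\<close>
text \<open>
  The closed formulas for the two steps replace the choice of the constants in the algorithm; each is
  built from measurable kernels by greedy shares and differences, with the roles of the two vertices
  exchanged for the rejection.
\<close>

lemma measurable_kernel_rejection:
  fixes w1 w2 :: "'m::metric_space rnet \<Rightarrow> real"
  assumes w1: "w1 \<in> borel_measurable borel" "\<And>z. 0 \<le> w1 z"
    and w2: "w2 \<in> borel_measurable borel" "\<And>z. 0 \<le> w2 z"
  shows "measurable_kernel (\<lambda>G. rejection G w1 w2 n)"
    and "measurable_kernel (\<lambda>G. applied G w1 w2 (rejection G w1 w2 n))"
proof -
  have demands: "network_demands G w1 w2" if "is_network G" for G :: "'m network"
    using that w1(2) w2(2) by unfold_locales
  have app: "measurable_kernel (\<lambda>G. applied G w1 w2 (rejection G w1 w2 n))"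
    if rej: "measurable_kernel (\<lambda>G. rejection G w1 w2 n)" for n
  proof -
    let ?f = "\<lambda>G u v. w2 (rcls G v) - rejection G w1 w2 n u v"
    have f: "measurable_kernel ?f"
      by (intro measurable_kernel_diff rej measurable_kernel_transpose[OF measurable_kernel_fst[OF w2(1)]])
    have nonneg: "0 \<le> ?f G u v" if "is_network G" "u \<in> verts G" "v \<in> verts G" for G :: "'m network" and u v
    proof -
      interpret network_demands G w1 w2 by (rule demands) fact
      show ?thesis using admissible_rejection[of n] that by (simp add: admissible_def)
    qed
    show ?thesis
    proof (rule measurable_kernel_cong[OF measurable_kernel_add[OF rej measurable_kernel_greedy[OF w1(1) f nonneg]]])
      fix G :: "'m network" and u v assume G: "is_network G" "u \<in> verts G" "v \<in> verts G"
      interpret network_demands G w1 w2 by (rule demands) fact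
      show "applied G w1 w2 (rejection G w1 w2 n) u v =
          rejection G w1 w2 n u v + greedy (verts G) (gdist G u) (w1 (rcls G u)) (?f G u) v"
        using applied_eq_greedy[OF admissible_rejection G(2,3)] by (simp add: unrejected_def[abs_def])
    qed
  qed
  have rej: "measurable_kernel (\<lambda>G. rejection G w1 w2 n)" for n
  proof (induction n)
    case 0
    show ?case by (rule measurable_kernelI[of "\<lambda>_. 0"]) auto
  next
    case (Suc n)
    let ?f = "\<lambda>G u v. applied G w1 w2 (rejection G w1 w2 n) v u"
    have f: "measurable_kernel ?f" by (rule measurable_kernel_transpose[OF app[OF Suc]])
    have nonneg: "0 \<le> ?f G u v" if "is_network G" "u \<in> verts G" "v \<in> verts G" for G :: "'m network" and u v
      by (rule network_demands.applied_nonneg[OF demands]) fact+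
    show ?case
    proof (rule measurable_kernel_cong[OF measurable_kernel_diff[OF app[OF Suc]
            measurable_kernel_transpose[OF measurable_kernel_greedy[OF w2(1) f nonneg]]]])
      fix G :: "'m network" and u v assume G: "is_network G" "u \<in> verts G" "v \<in> verts G"
      interpret network_demands G w1 w2 by (rule demands) fact
      show "rejection G w1 w2 (Suc n) u v = applied G w1 w2 (rejection G w1 w2 n) u v -
          greedy (verts G) (gdist G v) (w2 (rcls G v)) (?f G v) u"
        using rejected_eq_greedy[where A = "applied G w1 w2 (rejection G w1 w2 n)", OF applied_nonneg[OF _ G(3)] G(2,3)]
        by simp
    qed
  qed
  show "measurable_kernel (\<lambda>G. rejection G w1 w2 n)" by (rule rej)
  show "measurable_kernel (\<lambda>G. applied G w1 w2 (rejection G w1 w2 n))" by (rule app[OF rej])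
qed

lemma measurable_kernel_stable_transport:
  fixes w1 w2 :: "'m::metric_space rnet \<Rightarrow> real"
  assumes "w1 \<in> borel_measurable borel" "\<And>z. 0 \<le> w1 z" "w2 \<in> borel_measurable borel" "\<And>z. 0 \<le> w2 z"
  shows "measurable_kernel (\<lambda>G. stable_transport G w1 w2)"
proof -
  have "measurable_kernel (\<lambda>G u v. lim (\<lambda>n. applied G w1 w2 (rejection G w1 w2 (n - 1)) u v))"
    by (rule measurable_kernel_lim) (rule measurable_kernel_rejection(2)[OF assms])
  moreover have "measurable_kernel (\<lambda>G u v. lim (\<lambda>n. rejection G w1 w2 n u v))"
    by (rule measurable_kernel_lim) (rule measurable_kernel_rejection(1)[OF assms])
  ultimately show ?thesis
    unfolding stable_transport_def[abs_def] application_def by (rule measurable_kernel_diff)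
qed

section \<open>Mass transport and invariant events\<close>

lemma nn_integral_count_space_eq_infsum:
  fixes f :: "nat \<Rightarrow> ennreal"
  shows "(\<integral>\<^sup>+v. f v \<partial>count_space A) = infsum f A"
proof -
  let ?f = "\<lambda>v. f v * indicator A v"
  have "(\<integral>\<^sup>+v. f v \<partial>count_space A) = (\<integral>\<^sup>+v. ?f v \<partial>count_space UNIV)"
    by (cases "A = UNIV") (auto simp: nn_integral_count_space_indicator)
  also have "\<dots> = suminf ?f" by (rule nn_integral_count_space_nat)
  also have "\<dots> = infsum ?f UNIV"
    by (rule sums_unique[symmetric] has_sum_imp_sums has_sum_infsum nonneg_summable_on_complete zero_le)+
  also have "\<dots> = infsum f A" by (rule infsum_cong_neutral) auto
  finally show ?thesis .
qed

lemma outflow_eq_vertex_sum: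
  "is_network G \<Longrightarrow> u \<in> verts G \<Longrightarrow> outflow T G u = vertex_sum (\<lambda>y. ennreal (T y)) (rcls G u)"
  by (simp add: outflow_def vertex_sum_rcls nn_integral_count_space_eq_infsum)

lemma inflow_eq_vertex_sum:
  assumes "is_network G" "u \<in> verts G"
  shows "inflow T G u = vertex_sum (\<lambda>y. ennreal (T (flip y))) (rcls G u)"
  unfolding inflow_def vertex_sum_rcls[OF assms] nn_integral_count_space_eq_infsum
  by (rule infsum_cong) (simp add: flip_dcls assms)

lemma unimodular_vertex_sum:
  assumes "unimodular M X" "g \<in> borel_measurable borel" "\<And>y. 0 \<le> g y"
  shows "(\<integral>\<^sup>+\<omega>. vertex_sum (\<lambda>y. ennreal (g y)) (X \<omega>) \<partial>M) =
    (\<integral>\<^sup>+\<omega>. vertex_sum (\<lambda>y. ennreal (g (flip y))) (X \<omega>) \<partial>M)"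
proof -
  have out: "case_prod (outflow g) (rep_rnet x) = vertex_sum (\<lambda>y. ennreal (g y)) x" for x
    by (rule rep_rnet_network[of x]) (simp add: outflow_eq_vertex_sum)
  have into: "case_prod (inflow g) (rep_rnet x) = vertex_sum (\<lambda>y. ennreal (g (flip y))) x" for x
    by (rule rep_rnet_network[of x]) (simp add: inflow_eq_vertex_sum)
  have "(\<integral>\<^sup>+\<omega>. case_prod (outflow g) (rep_rnet (X \<omega>)) \<partial>M) = (\<integral>\<^sup>+\<omega>. case_prod (inflow g) (rep_rnet (X \<omega>)) \<partial>M)"
    using assms unfolding unimodular_def by blast
  then show ?thesis by (simp only: out into)
qed

text \<open>
  Phrased as the absence of exceptional vertices, so that the measurability of vertex sums applies.
\<close>

definition everywhere :: "'m rnet set \<Rightarrow> 'm rnet set" where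
  "everywhere Q = {x. vertex_sum (\<lambda>y. indicator (- Q) (fst_root (flip y))) x = 0}"

lemma rcls_in_everywhere_iff:
  assumes "is_network G" "u \<in> verts G"
  shows "rcls G u \<in> everywhere Q \<longleftrightarrow> (\<forall>v\<in>verts G. rcls G v \<in> Q)"
proof -
  have "vertex_sum (\<lambda>y. indicator (- Q) (fst_root (flip y))) (rcls G u) =
      (\<integral>\<^sup>+v. indicator (- Q) (rcls G v) \<partial>count_space (verts G))"
    unfolding vertex_sum_rcls[OF assms]
    by (rule nn_integral_cong) (simp add: flip_dcls fst_root_dcls assms)
  then show ?thesis
    by (simp add: everywhere_def nn_integral_0_iff_AE AE_count_space indicator_eq_0_iff)
qed

lemma everywhere_invariant:
  assumes [measurable]: "Q \<in> sets borel"
  shows "everywhere Q \<in> invariant_sets"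
proof -
  have "vertex_sum (\<lambda>y. indicator (- Q) (fst_root (flip y))) \<in> borel_measurable borel"
    by (rule measurable_vertex_sum) measurable
  then have "everywhere Q \<inter> space borel \<in> sets borel" unfolding everywhere_def by measurable
  then show ?thesis by (auto simp: invariant_sets_def rcls_in_everywhere_iff)
qed

text \<open>
  Let every vertex send mass 1 to each vertex whose class is outside \<open>Q\<close>. The root receives mass only
  if its own class is outside \<open>Q\<close>, hence almost surely none. By unimodularity it almost surely sends
  none either, so there are no exceptional vertices.
\<close>

lemma AE_everywhere:
  fixes X :: "'w \<Rightarrow> 'm::metric_space rnet"
  assumes uni: "unimodular M X" and [measurable]: "X \<in> measurable M borel" "Q \<in> sets borel"
    and AE: "AE \<omega> in M. X \<omega> \<in> Q"
  shows "AE \<omega> in M. X \<omega> \<in> everywhere Q"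
proof -
  let ?bad = "\<lambda>y. indicator (- Q) (fst_root (flip y)) :: real"
  have bad_meas: "?bad \<in> borel_measurable borel" by measurable
  have [measurable]: "vertex_sum (\<lambda>y. ennreal (?bad y)) \<in> borel_measurable borel"
    by (rule measurable_vertex_sum) measurable
  have "(\<integral>\<^sup>+\<omega>. vertex_sum (\<lambda>y. ennreal (?bad y)) (X \<omega>) \<partial>M) =
      (\<integral>\<^sup>+\<omega>. vertex_sum (\<lambda>y. ennreal (?bad (flip y))) (X \<omega>) \<partial>M)"
    by (rule unimodular_vertex_sum[OF uni bad_meas]) simp
  also have "\<dots> = (\<integral>\<^sup>+\<omega>. 0 \<partial>M)"
  proof (rule nn_integral_cong_AE)
    show "AE \<omega> in M. vertex_sum (\<lambda>y. ennreal (?bad (flip y))) (X \<omega>) = 0"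
      using AE
    proof eventually_elim
      case (elim \<omega>)
      obtain G u where G: "is_network G" "u \<in> verts G" and x: "X \<omega> = rcls G u" using rnet_cases[of "X \<omega>"] .
      have "vertex_sum (\<lambda>y. ennreal (?bad (flip y))) (rcls G u) = (\<integral>\<^sup>+v. 0 \<partial>count_space (verts G))"
        unfolding vertex_sum_rcls[OF G]
        by (rule nn_integral_cong) (use elim x in \<open>simp add: flip_dcls fst_root_dcls G\<close>)
      then show ?case by (simp add: x)
    qed
  qed
  finally have "AE \<omega> in M. vertex_sum (\<lambda>y. ennreal (?bad y)) (X \<omega>) = 0"
    by (simp add: nn_integral_0_iff_AE)
  then show ?thesis by (simp add: everywhere_def ennreal_indicator)
qed

lemma invariant_sets_iff:
  assumes "A \<in> invariant_sets" "is_network G" "u \<in> verts G" "v \<in> verts G"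
  shows "rcls G u \<in> A \<longleftrightarrow> rcls G v \<in> A"
  using assms unfolding invariant_sets_def by blast

lemma invariant_sets_borel: "A \<in> invariant_sets \<Longrightarrow> A \<in> sets borel"
  by (simp add: invariant_sets_def)

lemma invariant_setsI:
  assumes "A \<in> sets borel"
    "\<And>G u v. is_network G \<Longrightarrow> u \<in> verts G \<Longrightarrow> v \<in> verts G \<Longrightarrow> rcls G u \<in> A \<Longrightarrow> rcls G v \<in> A"
  shows "A \<in> invariant_sets"
  using assms unfolding invariant_sets_def by blast

lemma invariant_sets_Compl:
  assumes "A \<in> invariant_sets" shows "- A \<in> invariant_sets"
proof (rule invariant_setsI)
  show "- A \<in> sets borel" using invariant_sets_borel[OF assms] by simp
qed (use invariant_sets_iff[OF assms] in blast)

lemma invariant_sets_Int: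
  assumes "A \<in> invariant_sets" "B \<in> invariant_sets" shows "A \<inter> B \<in> invariant_sets"
proof (rule invariant_setsI)
  show "A \<inter> B \<in> sets borel" by (intro sets.Int invariant_sets_borel assms)
qed (use invariant_sets_iff[OF assms(1)] invariant_sets_iff[OF assms(2)] in blast)

lemma invariant_sets_UN:
  assumes "\<And>i :: nat. A i \<in> invariant_sets" shows "(\<Union>i. A i) \<in> invariant_sets"
proof (rule invariant_setsI)
  show "(\<Union>i. A i) \<in> sets borel" using invariant_sets_borel[OF assms] by (intro sets.countable_UN) auto
qed (use invariant_sets_iff[OF assms] in blast)

lemma space_invariant_field [simp]: "space (invariant_field M X) = space M"
  by (simp add: invariant_field_def space_measure_of_conv)

text \<open>
  The preimages of invariant sets already form a sigma-field. Consequently the level sets of a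
  conditional expectation are preimages of invariant sets, and mass transport can be restricted to
  them.
\<close>

lemma sets_invariant_field:
  "sets (invariant_field M X) = {X -` A \<inter> space M |A. A \<in> invariant_sets}"
proof -
  have "{X -` A \<inter> space M |A. A \<in> invariant_sets} \<subseteq> Pow (space M)" by auto
  then have "sets (invariant_field M X) = sigma_sets (space M) {X -` A \<inter> space M |A. A \<in> invariant_sets}"
    unfolding invariant_field_def by (rule sets_measure_of)
  also have "\<dots> = {X -` A \<inter> space M |A. A \<in> invariant_sets}"
  proof (intro equalityI subsetI)
    fix B assume "B \<in> sigma_sets (space M) {X -` A \<inter> space M |A. A \<in> invariant_sets}"
    then show "B \<in> {X -` A \<inter> space M |A. A \<in> invariant_sets}"
    proof induction
      case Empty
      have "{} \<in> invariant_sets" by (simp add: invariant_sets_def)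
      then show ?case by (intro CollectI exI[of _ "{}"]) simp
    next
      case (Compl B)
      then obtain A where "A \<in> invariant_sets" "B = X -` A \<inter> space M" by blast
      then show ?case by (intro CollectI exI[of _ "- A"]) (auto simp: invariant_sets_Compl)
    next
      case (Union B)
      then obtain A where "\<And>i. A i \<in> invariant_sets" "\<And>i. B i = X -` A i \<inter> space M"
        by (simp, metis)
      then show ?case by (intro CollectI exI[of _ "\<Union>i. A i"]) (auto simp: invariant_sets_UN)
    qed simp
  qed auto
  finally show ?thesis .
qed

lemma subalgebra_invariant_field:
  assumes "X \<in> measurable M borel"
  shows "subalgebra M (invariant_field M X)"
  unfolding subalgebra_def sets_invariant_field
  using measurable_sets[OF assms] invariant_sets_borel by auto

lemma AE_eq_of_nn_integral_le:
  fixes f g :: "'w \<Rightarrow> ennreal"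
  assumes "f \<in> borel_measurable M" "g \<in> borel_measurable M" "\<And>\<omega>. f \<omega> \<le> g \<omega>"
    and "integral\<^sup>N M g \<le> integral\<^sup>N M f" "integral\<^sup>N M g < \<infinity>"
  shows "AE \<omega> in M. f \<omega> = g \<omega>"
proof -
  have "integral\<^sup>N M f \<le> integral\<^sup>N M g" by (rule nn_integral_mono) (rule assms(3))
  then have "integral\<^sup>N M f \<noteq> \<infinity>" using assms(5) by auto
  have "AE \<omega> in M. g \<omega> \<le> f \<omega>"
  proof (rule ccontr)
    assume "\<not> (AE \<omega> in M. g \<omega> \<le> f \<omega>)"
    with \<open>integral\<^sup>N M f \<noteq> \<infinity>\<close> have "integral\<^sup>N M f < integral\<^sup>N M g"
      by (intro nn_integral_less assms(1,2)) (simp_all add: assms(3))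
    with assms(4) show False by simp
  qed
  then show ?thesis by eventually_elim (rule order_antisym[OF assms(3)])
qed

text \<open>
  Multiply the kernel by the indicator of \<open>A\<close> at the first root. Since \<open>A\<close> is invariant, the same
  factor appears at the second root, so it comes out of the outflow and of the inflow.
\<close>

lemma unimodular_restricted:
  fixes X :: "'w \<Rightarrow> 'm::metric_space rnet"
  assumes uni: "unimodular M X" and A: "A \<in> invariant_sets"
    and [measurable]: "T \<in> borel_measurable borel" and T: "\<And>y. 0 \<le> T y"
  shows "(\<integral>\<^sup>+\<omega>. vertex_sum (\<lambda>y. ennreal (T y)) (X \<omega>) * indicator A (X \<omega>) \<partial>M) =
    (\<integral>\<^sup>+\<omega>. vertex_sum (\<lambda>y. ennreal (T (flip y))) (X \<omega>) * indicator A (X \<omega>) \<partial>M)"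
proof -
  define g where "g y = T y * indicator A (fst_root y)" for y
  have A_borel [measurable]: "A \<in> sets borel" by (rule invariant_sets_borel[OF A])
  have g_meas: "g \<in> borel_measurable borel" unfolding g_def[abs_def] by measurable
  have g_nonneg: "0 \<le> g y" for y by (simp add: g_def T)
  have out: "vertex_sum (\<lambda>y. ennreal (g y)) x = vertex_sum (\<lambda>y. ennreal (T y)) x * indicator A x"
    and into: "vertex_sum (\<lambda>y. ennreal (g (flip y))) x = vertex_sum (\<lambda>y. ennreal (T (flip y))) x * indicator A x" for x
  proof -
    obtain G u where G: "is_network G" "u \<in> verts G" and x: "x = rcls G u" using rnet_cases[of x] .
    have "g (dcls G u v) = T (dcls G u v) * indicator A x"
      and "g (dcls G v u) = T (dcls G v u) * indicator A x" if "v \<in> verts G" for v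
      using invariant_sets_iff[OF A G that] that G by (simp_all add: g_def fst_root_dcls x indicator_def)
    then show "vertex_sum (\<lambda>y. ennreal (g y)) x = vertex_sum (\<lambda>y. ennreal (T y)) x * indicator A x"
      "vertex_sum (\<lambda>y. ennreal (g (flip y))) x = vertex_sum (\<lambda>y. ennreal (T (flip y))) x * indicator A x"
      using G by (cases "x \<in> A"; simp add: x vertex_sum_rcls flip_dcls cong: nn_integral_cong_simp)+
  qed
  show ?thesis
    using unimodular_vertex_sum[OF uni g_meas g_nonneg] by (simp only: out into)
qed

section \<open>Almost sure balance\<close>

theorem theorem7:
  fixes M :: "'w measure"
    and X :: "'w \<Rightarrow> 'm::polish_space rnet"
    and w1 w2 :: "'m rnet \<Rightarrow> real"
  assumes "prob_space M" and "X \<in> measurable M borel"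
    and "unimodular M X"
    and "w1 \<in> borel_measurable borel" and "\<And>x. 0 \<le> w1 x"
    and "w2 \<in> borel_measurable borel" and "\<And>x. 0 \<le> w2 x"
    and "AE \<omega> in M.
           nn_cond_exp M (invariant_field M X) (\<lambda>\<omega>. ennreal (w1 (X \<omega>))) \<omega> =
             nn_cond_exp M (invariant_field M X) (\<lambda>\<omega>. ennreal (w2 (X \<omega>))) \<omega> \<and>
           nn_cond_exp M (invariant_field M X) (\<lambda>\<omega>. ennreal (w2 (X \<omega>))) \<omega> < \<infinity>"
  shows "\<exists>T :: 'm dnet \<Rightarrow> real.
           (\<forall>G. is_network G \<longrightarrow>
              (\<forall>x\<in>verts G. \<forall>\<xi>\<in>verts G. T (dcls G x \<xi>) = stable_transport G w1 w2 x \<xi>)) \<and>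
           T \<in> borel_measurable borel \<and> (\<forall>y. 0 \<le> T y) \<and>
           (AE \<omega> in M. \<forall>G u. is_network G \<and> u \<in> verts G \<and> X \<omega> = rcls G u \<longrightarrow>
              (\<forall>v\<in>verts G. outflow T G v = ennreal (w1 (rcls G v)) \<and>
                           inflow T G v = ennreal (w2 (rcls G v))))"
proof -
  interpret prob_space M by (rule assms(1))
  note [measurable] = assms(2,4,6)
  define F where "F = invariant_field M X"
  interpret finite_measure_subalgebra M F
    by unfold_locales (simp add: F_def subalgebra_invariant_field assms(2))
  define E where "E w = nn_cond_exp M F (\<lambda>\<omega>. ennreal (w (X \<omega>)))" for w :: "'m rnet \<Rightarrow> real"
  have demands: "network_demands G w1 w2" if "is_network G" for G :: "'m network"
    using that assms(5,7) by unfold_locales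
  obtain h where [measurable]: "h \<in> borel_measurable borel" and
    h: "\<And>G u v. is_network G \<Longrightarrow> u \<in> verts G \<Longrightarrow> v \<in> verts G \<Longrightarrow> stable_transport G w1 w2 u v = h (dcls G u v)"
    using measurable_kernelE[OF measurable_kernel_stable_transport[OF assms(4-7)]] by blast
  \<comment> \<open>Every \<open>y\<close> is a class, so the maximum does not change \<open>h\<close>; it makes the sign evident.\<close>
  define T where "T y = max 0 (h y)" for y
  have T_meas [measurable]: "T \<in> borel_measurable borel" unfolding T_def[abs_def] by measurable
  have T_nonneg: "0 \<le> T y" for y by (simp add: T_def)
  have T: "T (dcls G u v) = stable_transport G w1 w2 u v"
    if "is_network G" "u \<in> verts G" "v \<in> verts G" for G u v
    using network_demands.stable_transport_balance(1)[OF demands[OF that(1)] that(2,3)] h[OF that] by (simp add: T_def)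
  define out where "out = vertex_sum (\<lambda>y. ennreal (T y))"
  define into where "into = vertex_sum (\<lambda>y. ennreal (T (flip y)))"
  have [measurable]: "out \<in> borel_measurable borel" "into \<in> borel_measurable borel"
    unfolding out_def into_def by (rule measurable_vertex_sum; measurable)+
  have out_rcls: "out (rcls G u) = (\<Sum>\<^sub>\<infinity>v\<in>verts G. ennreal (stable_transport G w1 w2 u v))"
    and into_rcls: "into (rcls G u) = (\<Sum>\<^sub>\<infinity>v\<in>verts G. ennreal (stable_transport G w1 w2 v u))"
    if G: "is_network G" "u \<in> verts G" for G u
    using outflow_eq_vertex_sum[OF G, of T] inflow_eq_vertex_sum[OF G, of T] T G
    by (simp_all add: out_def into_def outflow_def inflow_def cong: infsum_cong)
  have out_le: "out x \<le> ennreal (w1 x)" and into_le: "into x \<le> ennreal (w2 x)" for x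
    by (rule rnet_cases[of x]; simp add: out_rcls into_rcls network_demands.stable_transport_balance(2,3)[OF demands])+
  define Q1 where "Q1 = {x. out x = ennreal (w1 x)}"
  define Q2 where "Q2 = {x. into x = ennreal (w2 x)}"
  have "Q1 \<inter> space borel \<in> sets borel" "Q2 \<inter> space borel \<in> sets borel"
    unfolding Q1_def Q2_def by measurable
  then have Q [measurable]: "Q1 \<in> sets borel" "Q2 \<in> sets borel" by auto
  have dichotomy: "x \<in> everywhere Q1 \<or> x \<in> everywhere Q2" for x
  proof -
    obtain G u where G: "is_network G" "u \<in> verts G" and x: "x = rcls G u" using rnet_cases[of x] .
    show ?thesis
      using network_demands.stable_transport_balance(4)[OF demands[OF G(1)]]
      by (simp add: x rcls_in_everywhere_iff[OF G] Q1_def Q2_def out_rcls[OF G(1)] into_rcls[OF G(1)])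
  qed
  have E: "AE \<omega> in M. E w1 \<omega> = E w2 \<omega> \<and> E w2 \<omega> < \<infinity>"
    using assms(8) by (simp add: E_def F_def)
  \<comment> \<open>Truncating at \<open>k\<close> makes the integrals finite, so that equal integrals give equality.\<close>
  have balanced: "AE \<omega> in M. E w2 \<omega> \<le> of_nat k \<longrightarrow> X \<omega> \<in> Q1 \<inter> Q2" for k :: nat
  proof -
    have "E w2 \<in> borel_measurable F" unfolding E_def by simp
    then have "{\<omega> \<in> space F. E w2 \<omega> \<le> of_nat k} \<in> sets F" by measurable
    then obtain C where C: "C \<in> invariant_sets" "{\<omega> \<in> space M. E w2 \<omega> \<le> of_nat k} = X -` C \<inter> space M"
      unfolding F_def sets_invariant_field space_invariant_field by blast
    \<comment> \<open>Over invariant events, \<open>w (X \<omega>)\<close> may be replaced by its conditional expectation.\<close>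
    have mass: "(\<integral>\<^sup>+\<omega>. ennreal (w (X \<omega>)) * indicator A (X \<omega>) \<partial>M) = (\<integral>\<^sup>+\<omega>. indicator (X -` A \<inter> space M) \<omega> * E w \<omega> \<partial>M)"
      if "A \<in> invariant_sets" and [measurable]: "w \<in> borel_measurable borel" for A w
    proof -
      have "X -` A \<inter> space M \<in> sets F" using that(1) by (auto simp: F_def sets_invariant_field)
      then have "(\<integral>\<^sup>+\<omega>. indicator (X -` A \<inter> space M) \<omega> * E w \<omega> \<partial>M) =
          (\<integral>\<^sup>+\<omega>. indicator (X -` A \<inter> space M) \<omega> * ennreal (w (X \<omega>)) \<partial>M)"
        unfolding E_def by (intro nn_cond_exp_intg) auto
      also have "\<dots> = (\<integral>\<^sup>+\<omega>. ennreal (w (X \<omega>)) * indicator A (X \<omega>) \<partial>M)"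
        by (rule nn_integral_cong) (auto simp: indicator_def)
      finally show ?thesis by simp
    qed
    have mass_eq: "(\<integral>\<^sup>+\<omega>. ennreal (w1 (X \<omega>)) * indicator A (X \<omega>) \<partial>M) =
        (\<integral>\<^sup>+\<omega>. ennreal (w2 (X \<omega>)) * indicator A (X \<omega>) \<partial>M)" if "A \<in> invariant_sets" for A
      unfolding mass[OF that assms(4)] mass[OF that assms(6)]
      by (rule nn_integral_cong_AE) (use E in eventually_elim, simp)
    have mass_fin: "(\<integral>\<^sup>+\<omega>. ennreal (w2 (X \<omega>)) * indicator A (X \<omega>) \<partial>M) < \<infinity>"
      if "A \<in> invariant_sets" "A \<subseteq> C" for A
    proof -
      have "(\<integral>\<^sup>+\<omega>. ennreal (w2 (X \<omega>)) * indicator A (X \<omega>) \<partial>M) \<le> (\<integral>\<^sup>+\<omega>. of_nat k \<partial>M)"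
        unfolding mass[OF that(1) assms(6)]
      proof (rule nn_integral_mono)
        fix \<omega> assume "\<omega> \<in> space M"
        then show "indicator (X -` A \<inter> space M) \<omega> * E w2 \<omega> \<le> of_nat k"
          using C(2) that(2) by (cases "X \<omega> \<in> A") (auto simp: indicator_def)
      qed
      also have "\<dots> < \<infinity>" by (simp add: emeasure_space_1 ennreal_of_nat_neq_top less_top[symmetric])
      finally show ?thesis .
    qed
    note transport = unimodular_restricted[OF assms(3) _ T_meas T_nonneg, folded out_def into_def]
    have into_saturated: "AE \<omega> in M. X \<omega> \<in> A \<longrightarrow> X \<omega> \<in> Q2"
      if A: "A \<in> invariant_sets" "A \<subseteq> C" and "A \<subseteq> Q1" for A
    proof -
      have [measurable]: "A \<in> sets borel" using A(1) by (rule invariant_sets_borel)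
      have "(\<integral>\<^sup>+\<omega>. out (X \<omega>) * indicator A (X \<omega>) \<partial>M) = (\<integral>\<^sup>+\<omega>. ennreal (w1 (X \<omega>)) * indicator A (X \<omega>) \<partial>M)"
        by (rule nn_integral_cong) (use \<open>A \<subseteq> Q1\<close> in \<open>auto simp: Q1_def indicator_def\<close>)
      then have "(\<integral>\<^sup>+\<omega>. ennreal (w2 (X \<omega>)) * indicator A (X \<omega>) \<partial>M) \<le> (\<integral>\<^sup>+\<omega>. into (X \<omega>) * indicator A (X \<omega>) \<partial>M)"
        using transport[OF A(1)] mass_eq[OF A(1)] by simp
      then have "AE \<omega> in M. into (X \<omega>) * indicator A (X \<omega>) = ennreal (w2 (X \<omega>)) * indicator A (X \<omega>)"
        by (intro AE_eq_of_nn_integral_le mass_fin A) (auto intro!: mult_right_mono into_le)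
      then show ?thesis by eventually_elim (auto simp: Q2_def)
    qed
    have out_saturated: "AE \<omega> in M. X \<omega> \<in> A \<longrightarrow> X \<omega> \<in> Q1"
      if A: "A \<in> invariant_sets" "A \<subseteq> C" and "A \<subseteq> Q2" for A
    proof -
      have [measurable]: "A \<in> sets borel" using A(1) by (rule invariant_sets_borel)
      have "(\<integral>\<^sup>+\<omega>. into (X \<omega>) * indicator A (X \<omega>) \<partial>M) = (\<integral>\<^sup>+\<omega>. ennreal (w2 (X \<omega>)) * indicator A (X \<omega>) \<partial>M)"
        by (rule nn_integral_cong) (use \<open>A \<subseteq> Q2\<close> in \<open>auto simp: Q2_def indicator_def\<close>)
      then have "(\<integral>\<^sup>+\<omega>. ennreal (w1 (X \<omega>)) * indicator A (X \<omega>) \<partial>M) \<le> (\<integral>\<^sup>+\<omega>. out (X \<omega>) * indicator A (X \<omega>) \<partial>M)"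
        using transport[OF A(1)] mass_eq[OF A(1)] by simp
      then have "AE \<omega> in M. out (X \<omega>) * indicator A (X \<omega>) = ennreal (w1 (X \<omega>)) * indicator A (X \<omega>)"
        by (intro AE_eq_of_nn_integral_le) (auto intro!: mult_right_mono out_le simp: mass_eq[OF A(1)] mass_fin[OF A, unfolded infinity_ennreal_def])
      then show ?thesis by eventually_elim (auto simp: Q1_def)
    qed
    have sub: "everywhere Q \<subseteq> Q" for Q :: "'m rnet set"
    proof
      fix x :: "'m rnet" assume "x \<in> everywhere Q"
      then show "x \<in> Q" by (cases rule: rnet_cases[of x]) (auto simp: rcls_in_everywhere_iff)
    qed
    have inv: "C \<inter> everywhere Q1 \<in> invariant_sets" "C \<inter> everywhere Q2 \<in> invariant_sets"
      by (intro invariant_sets_Int C everywhere_invariant Q)+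
    have "AE \<omega> in M. X \<omega> \<in> C \<inter> everywhere Q1 \<longrightarrow> X \<omega> \<in> Q2"
      "AE \<omega> in M. X \<omega> \<in> C \<inter> everywhere Q2 \<longrightarrow> X \<omega> \<in> Q1"
      using sub[of Q1] sub[of Q2] by (intro into_saturated out_saturated inv; blast)+
    then show ?thesis
      using AE_space
    proof eventually_elim
      case (elim \<omega>)
      show ?case
      proof
        assume "E w2 \<omega> \<le> of_nat k"
        then have "X \<omega> \<in> C" using C(2) elim(3) by blast
        then show "X \<omega> \<in> Q1 \<inter> Q2"
          using elim(1,2) dichotomy[of "X \<omega>"] sub[of Q1] sub[of Q2] by blast
      qed
    qed
  qed
  have "AE \<omega> in M. \<forall>k. E w2 \<omega> \<le> of_nat k \<longrightarrow> X \<omega> \<in> Q1 \<inter> Q2"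
    unfolding AE_all_countable by (intro allI balanced)
  then have "AE \<omega> in M. X \<omega> \<in> Q1 \<inter> Q2"
    using E
  proof eventually_elim
    case (elim \<omega>)
    then obtain k where "E w2 \<omega> \<le> of_nat k"
      using ennreal_Ex_less_of_nat[of "E w2 \<omega>"] by (auto intro: less_imp_le)
    then show ?case using elim by blast
  qed
  then have "AE \<omega> in M. X \<omega> \<in> everywhere (Q1 \<inter> Q2)"
    by (rule AE_everywhere[OF assms(3,2) sets.Int[OF Q]])
  then have "AE \<omega> in M. \<forall>G u. is_network G \<and> u \<in> verts G \<and> X \<omega> = rcls G u \<longrightarrow>
      (\<forall>v\<in>verts G. outflow T G v = ennreal (w1 (rcls G v)) \<and> inflow T G v = ennreal (w2 (rcls G v)))"
  proof eventually_elim
    case (elim \<omega>)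
    show ?case
    proof (intro allI impI ballI)
      fix G u v assume G: "is_network G \<and> u \<in> verts G \<and> X \<omega> = rcls G u" and v: "v \<in> verts G"
      then have "rcls G v \<in> Q1 \<inter> Q2" using elim rcls_in_everywhere_iff[of G u] by auto
      then show "outflow T G v = ennreal (w1 (rcls G v)) \<and> inflow T G v = ennreal (w2 (rcls G v))"
        using G v by (simp add: outflow_eq_vertex_sum inflow_eq_vertex_sum Q1_def Q2_def out_def into_def)
    qed
  qed
  then show ?thesis using T T_meas T_nonneg by blast
qed

end
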